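(* Let $\mu=f\,dx$ with $f\ge0$, $f\in L^p(\Omega)$ for some $p>n$, and let $1/p+1/q=1$. Suppose $u$ is a parallel refractor satisfying $\mu(\mathcal T_u(E^\star))=\sigma(E^\star)$ for all Borel subsets $E^\star\subset\Sigma$. Assume: (a) $\Sigma$ is the graph of a $C^1$ function, $\Sigma=\{(y,\psi(y)):y\in\Omega^\star\}$ with $\Omega^\star$ a domain in $\mathbb{R}^n$; (b) for each $Y\in\Sigma$ and each $X\in C_\Omega$, the line $\{X+s(Y-X):s\in\mathbb{R}\}$ is not contained in the tangent plane $T_Y$ to $\Sigma$ at $Y$, that is, it intersects $T_Y$ only at $Y$; (c) if $E\subset\Sigma$ and $|\{y\in\Omega^\star:(y,\psi(y))\in E\}|=0$, then $\sigma(E)=0$. Suppose moreover that $\Sigma$ is regular from $X^\star=(x^\star,u(x^\star))\in C_\Omega$ and that the tube condition holds at $X^\star$. Then there exist $\delta>0$ and $C>0$ depending on $X^\star$ such that $u\in C^{1,\alpha}(B_\delta(x^\star))$ (with constant $C$, i.e. $|Du(\bar x)-Du(\hat x)|\le C|\bar x-\hat x|^\alpha$ for all $\bar x,\hat x\in B_\delta(x^\star)$), where $$\alpha=\frac{\frac{n}{2q}-\frac{n-1}{2}}{1+\frac32(n-1)+\frac{n}{2q}}.$$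
   Context: Fix an integer $n\ge2$, constants $0<\kappa<1$, $M_0>0$, $0<\delta_0<1$, and a bounded domain $\Omega\subset\mathbb{R}^n$. Points of $\mathbb{R}^{n+1}$ are written $X=(x,x_{n+1})$ with $x\in\mathbb{R}^n$ (likewise $Y=(y,y_{n+1})$, $Z=(z,z_{n+1})$, $X_0=(x_0,x_{0,n+1})$); $B_r(a)$ is the ball of radius $r$ centered at $a$, $|\cdot|$ of a set is Lebesgue measure, and $N_\rho(E)$ is the $\rho$-neighborhood of $E$ in $\mathbb{R}^{n+1}$. Set $C_\Omega=\Omega\times(0,M_0)$, $$c(X,Y)=|X-Y|+\kappa(x_{n+1}-y_{n+1}),$$ $$\phi(x,Y,X_0)=y_{n+1}-\frac{\kappa\,c(X_0,Y)}{1-\kappa^2}-\sqrt{\frac{c(X_0,Y)^2}{(1-\kappa^2)^2}-\frac{|x-y|^2}{1-\kappa^2}}\quad\text{for } |x-y|\le \frac{c(X_0,Y)}{\sqrt{1-\kappa^2}}.$$ $D_x\phi$ is the gradient in $x$. Let $\mathcal T$ be the set of $Y\in\mathbb{R}^{n+1}$ such that for every $X_0\in C_\Omega$: $x_{0,n+1}\le y_{n+1}-\frac{\kappa c(X_0,Y)}{1-\kappa^2}$ and $\Omega\subset B_{\delta_0c(X_0,Y)/\sqrt{1-\kappa^2}}(y)$. For $v\in\mathbb{R}^n$ let $$Q(v)=\frac{\sqrt{1+(1-\kappa^2)|v|^2}-\kappa}{1+|v|^2},\qquad \Lambda(v)=(-Q(v)v,\;Q(v)+\kappa),$$ a unit vector.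 Target: $\Sigma\subset\mathbb{R}^{n+1}$ is a domain contained in an $n$-dimensional surface, its convex hull is contained in $\mathcal T$, and for each $X\in C_\Omega$ every $Y\in\Sigma$ is represented parametrically from $X$ as $Y=X+s_X(\Lambda)\Lambda$, $|\Lambda|=1$, with $s_X$ a positive function of the direction that is Lipschitz and of class $C^2$. $\sigma$ is a Borel measure on $\Sigma$, with $\mu(\Omega)=\sigma(\Sigma)$. For $\bar Y,\hat Y\in\Sigma$ and $Z\in C_\Omega$ put $\bar v=D_x\phi(z,\bar Y,Z)$, $\hat v=D_x\phi(z,\hat Y,Z)$, $v(\lambda)=(1-\lambda)\bar v+\lambda\hat v$, and $Y_Z(\lambda)=Z+s_Z(\Lambda(v(\lambda)))\Lambda(v(\lambda))$. It is assumed that $[\bar Y,\hat Y]_Z:=\Sigma\cap\{Z+s\Lambda(v(\lambda)):s>0,\lambda\in[0,1]\}$ is a curve, i.e. for every $\lambda\in[0,1]$ the ray from $Z$ in direction $\Lambda(v(\lambda))$ meets $\Sigma$, at the single point $Y_Z(\lambda)$. Regularity of the target: $\Sigma$ is regular from $X_0\in C_\Omega$ if there exist a neighborhood $U_{X_0}$ of $X_0$ and positive constants $c_1,c_2$, depending on $U_{X_0}$, such that for all $\bar Y,\hat Y\in\Sigma$, $Z\in U_{X_0}$, $1/4\le\lambda\le3/4$ and $x\in\Omega$ with $|x-z|\le c_2$, $$\phi(x,Y_Z(\lambda),Z)\ge\min\{\phi(x,\bar Y,Z),\phi(x,\hat Y,Z)\}+c_1|\bar Y-\hat Y|^2|x-z|^2.$$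 Tube condition at $X_0\in C_\Omega$: there exist a neighborhood $U_{X_0}$ of $X_0$ and a constant $\hat C>0$, depending on $X_0$, such that $$\sigma\big(N_\rho(\{Y_Z(\lambda):\lambda\in[1/4,3/4]\})\cap\Sigma\big)\ge\hat C\,\rho^{n-1}|\bar Y-\hat Y|$$ for all $\bar Y,\hat Y\in\Sigma$, all $Z\in U_{X_0}$ and all sufficiently small $\rho>0$ (smallness depending on $X_0$). Parallel refractor: a function $u:\Omega\to[0,M_0]$ such that for every $x_0\in\Omega$ the set $F_u(x_0)=\{Y\in\Sigma: u(x)\le\phi(x,Y,X_0)\ \text{for all }x\in\Omega\}$, $X_0=(x_0,u(x_0))$, is nonempty. For $E^\star\subset\Sigma$, $\mathcal T_u(E^\star)=\{x\in\Omega:F_u(x)\cap E^\star\ne\emptyset\}$. *)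

theory Defs
  imports "HOL-Analysis.Analysis"
begin

text \<open>A point \<open>X = (x, x\<^sub>n\<^sub>+\<^sub>1)\<close> of \<open>(n+1)\<close>-dimensional Euclidean space is a pair; the product type
  carries the Euclidean norm.\<close>

type_synonym 'n point = "(real^'n) \<times> real"


definition is_domain :: "'a::topological_space set \<Rightarrow> bool" where
  "is_domain A \<longleftrightarrow> open A \<and> connected A \<and> A \<noteq> {}"

definition C1_on :: "'a::real_normed_vector set \<Rightarrow> ('a \<Rightarrow> 'b::real_normed_vector) \<Rightarrow> bool" where
  "C1_on U f \<longleftrightarrow> (\<exists>f'. (\<forall>x\<in>U. (f has_derivative blinfun_apply (f' x)) (at x)) \<and> continuous_on U f')"

definition C2_on :: "'a::real_normed_vector set \<Rightarrow> ('a \<Rightarrow> 'b::real_normed_vector) \<Rightarrow> bool" where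
  "C2_on U f \<longleftrightarrow> (\<exists>f'. (\<forall>x\<in>U. (f has_derivative blinfun_apply (f' x)) (at x)) \<and> C1_on U f')"

text \<open>Class \<open>C\<^sup>2\<close> on a set that need not be open in the ambient space (here: a set of unit vectors)
  means being the restriction of a \<open>C\<^sup>2\<close> function on an open superset.\<close>

definition C2_on_subset :: "'a::real_normed_vector set \<Rightarrow> ('a \<Rightarrow> 'b::real_normed_vector) \<Rightarrow> bool" where
  "C2_on_subset D f \<longleftrightarrow> (\<exists>U g. open U \<and> D \<subseteq> U \<and> C2_on U g \<and> (\<forall>x\<in>D. g x = f x))"

definition gradient :: "('a::real_inner \<Rightarrow> real) \<Rightarrow> 'a \<Rightarrow> 'a" where
  "gradient f x = (THE D. GDERIV f x :> D)"

text \<open>A set of dimension \<open>n\<close> in the sense of topological manifolds; no smoothness is imposed here.\<close>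

definition is_surface :: "'n::finite point set \<Rightarrow> bool" where
  "is_surface M \<longleftrightarrow> (\<forall>P\<in>M. \<exists>U V. openin (top_of_set M) U \<and> P \<in> U \<and>
      open (V :: (real^'n) set) \<and> U homeomorphic V)"

definition is_domain_in_surface :: "'n::finite point set \<Rightarrow> bool" where
  "is_domain_in_surface S \<longleftrightarrow> (\<exists>M. is_surface M \<and> openin (top_of_set M) S \<and> connected S \<and> S \<noteq> {})"

definition nbhd_of_set :: "real \<Rightarrow> 'a::metric_space set \<Rightarrow> 'a set" where
  "nbhd_of_set \<rho> E = (\<Union>e\<in>E. ball e \<rho>)"

text \<open>The exponent is an extended real, so that \<open>p = \<infinity>\<close> (essential boundedness) is included.\<close>

definition in_Lp :: "ereal \<Rightarrow> 'a::euclidean_space set \<Rightarrow> ('a \<Rightarrow> real) \<Rightarrow> bool" where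
  "in_Lp p \<Omega> f \<longleftrightarrow> f \<in> borel_measurable (lebesgue_on \<Omega>) \<and>
     (if p = \<infinity> then \<exists>K. AE x in lebesgue_on \<Omega>. \<bar>f x\<bar> \<le> K
      else integrable (lebesgue_on \<Omega>) (\<lambda>x. \<bar>f x\<bar> powr real_of_ereal p))"


definition cylinder :: "(real^'n) set \<Rightarrow> real \<Rightarrow> 'n::finite point set" where
  "cylinder \<Omega> M0 = \<Omega> \<times> {0<..<M0}"

definition cost :: "real \<Rightarrow> 'n::finite point \<Rightarrow> 'n point \<Rightarrow> real" where
  "cost \<kappa> X Y = norm (X - Y) + \<kappa> * (snd X - snd Y)"

text \<open>Only meaningful for \<open>norm (x - fst Y) \<le> cost \<kappa> X0 Y / sqrt (1 - \<kappa>\<^sup>2)\<close>; this holds wherever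
  it is used, by the definition of \<open>admissible_targets\<close> (for \<open>X0\<close> in the closure of the cylinder, by
  passing to the limit).\<close>

definition phi :: "real \<Rightarrow> real^'n \<Rightarrow> 'n::finite point \<Rightarrow> 'n point \<Rightarrow> real" where
  "phi \<kappa> x Y X0 = snd Y - \<kappa> * cost \<kappa> X0 Y / (1 - \<kappa>\<^sup>2)
     - sqrt ((cost \<kappa> X0 Y)\<^sup>2 / (1 - \<kappa>\<^sup>2)\<^sup>2 - (norm (x - fst Y))\<^sup>2 / (1 - \<kappa>\<^sup>2))"

definition admissible_targets ::
    "real \<Rightarrow> real \<Rightarrow> real \<Rightarrow> (real^'n) set \<Rightarrow> 'n::finite point set" where
  "admissible_targets \<kappa> M0 \<delta>0 \<Omega> = {Y. \<forall>X0\<in>cylinder \<Omega> M0.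
      snd X0 \<le> snd Y - \<kappa> * cost \<kappa> X0 Y / (1 - \<kappa>\<^sup>2) \<and>
      \<Omega> \<subseteq> ball (fst Y) (\<delta>0 * cost \<kappa> X0 Y / sqrt (1 - \<kappa>\<^sup>2))}"

definition Q :: "real \<Rightarrow> real^'n::finite \<Rightarrow> real" where
  "Q \<kappa> v = (sqrt (1 + (1 - \<kappa>\<^sup>2) * (norm v)\<^sup>2) - \<kappa>) / (1 + (norm v)\<^sup>2)"

definition Lam :: "real \<Rightarrow> real^'n \<Rightarrow> 'n::finite point" where
  "Lam \<kappa> v = (- (Q \<kappa> v *\<^sub>R v), Q \<kappa> v + \<kappa>)"

definition directions :: "'n::finite point set \<Rightarrow> 'n point \<Rightarrow> 'n point set" where
  "directions S X = {L. norm L = 1 \<and> (\<exists>r>0. X + r *\<^sub>R L \<in> S)}"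

text \<open>The family \<open>s\<close> of radial functions represents the target from every point of the cylinder.
  Only the values of \<open>s X\<close> on the directions pointing from \<open>X\<close> to the target matter.\<close>

definition parametrized_by ::
    "'n::finite point set \<Rightarrow> 'n point set \<Rightarrow> ('n point \<Rightarrow> 'n point \<Rightarrow> real) \<Rightarrow> bool" where
  "parametrized_by C S s \<longleftrightarrow> (\<forall>X\<in>C.
      (\<forall>Y\<in>S. \<exists>L. norm L = 1 \<and> s X L > 0 \<and> Y = X + s X L *\<^sub>R L) \<and>
      (\<forall>L\<in>directions S X. s X L > 0) \<and>
      (\<exists>K. K-lipschitz_on (directions S X) (s X)) \<and>
      C2_on_subset (directions S X) (s X))"

definition v_interp ::
    "real \<Rightarrow> 'n::finite point \<Rightarrow> 'n point \<Rightarrow> 'n point \<Rightarrow> real \<Rightarrow> real^'n" where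
  "v_interp \<kappa> Z Y1 Y2 l = (1 - l) *\<^sub>R gradient (\<lambda>x. phi \<kappa> x Y1 Z) (fst Z)
      + l *\<^sub>R gradient (\<lambda>x. phi \<kappa> x Y2 Z) (fst Z)"

definition Ycurve :: "real \<Rightarrow> ('n point \<Rightarrow> 'n point \<Rightarrow> real) \<Rightarrow>
    'n::finite point \<Rightarrow> 'n point \<Rightarrow> 'n point \<Rightarrow> real \<Rightarrow> 'n point" where
  "Ycurve \<kappa> s Z Y1 Y2 l = (let L = Lam \<kappa> (v_interp \<kappa> Z Y1 Y2 l) in Z + s Z L *\<^sub>R L)"

definition curve_condition :: "real \<Rightarrow> 'n::finite point set \<Rightarrow> 'n point set \<Rightarrow>
    ('n point \<Rightarrow> 'n point \<Rightarrow> real) \<Rightarrow> bool" where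
  "curve_condition \<kappa> C S s \<longleftrightarrow> (\<forall>Y1\<in>S. \<forall>Y2\<in>S. \<forall>Z\<in>C. \<forall>l\<in>{0..1}.
      S \<inter> {Z + r *\<^sub>R Lam \<kappa> (v_interp \<kappa> Z Y1 Y2 l) |r. r > 0} = {Ycurve \<kappa> s Z Y1 Y2 l})"

definition regular_from :: "real \<Rightarrow> real \<Rightarrow> (real^'n) set \<Rightarrow> 'n::finite point set \<Rightarrow>
    ('n point \<Rightarrow> 'n point \<Rightarrow> real) \<Rightarrow> 'n point \<Rightarrow> bool" where
  "regular_from \<kappa> M0 \<Omega> S s X0 \<longleftrightarrow>
    (\<exists>U c1 c2. open U \<and> X0 \<in> U \<and> U \<subseteq> cylinder \<Omega> M0 \<and> c1 > 0 \<and> c2 > 0 \<and>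
      (\<forall>Y1\<in>S. \<forall>Y2\<in>S. \<forall>Z\<in>U. \<forall>l\<in>{1/4..3/4}. \<forall>x\<in>\<Omega>. norm (x - fst Z) \<le> c2 \<longrightarrow>
        phi \<kappa> x (Ycurve \<kappa> s Z Y1 Y2 l) Z
          \<ge> min (phi \<kappa> x Y1 Z) (phi \<kappa> x Y2 Z)
             + c1 * (norm (Y1 - Y2))\<^sup>2 * (norm (x - fst Z))\<^sup>2))"

definition tube_condition :: "real \<Rightarrow> real \<Rightarrow> (real^'n) set \<Rightarrow> 'n::finite point set \<Rightarrow>
    ('n point \<Rightarrow> 'n point \<Rightarrow> real) \<Rightarrow> 'n point measure \<Rightarrow> 'n point \<Rightarrow> bool" where
  "tube_condition \<kappa> M0 \<Omega> S s \<sigma> X0 \<longleftrightarrow>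
    (\<exists>U c \<rho>0. open U \<and> X0 \<in> U \<and> U \<subseteq> cylinder \<Omega> M0 \<and> c > 0 \<and> \<rho>0 > 0 \<and>
      (\<forall>Y1\<in>S. \<forall>Y2\<in>S. \<forall>Z\<in>U. \<forall>\<rho>. 0 < \<rho> \<and> \<rho> < \<rho>0 \<longrightarrow>
        emeasure \<sigma> (nbhd_of_set \<rho> (Ycurve \<kappa> s Z Y1 Y2 ` {1/4..3/4}) \<inter> S)
          \<ge> ennreal (c * \<rho> ^ (CARD('n) - 1) * norm (Y1 - Y2))))"

definition refractor_map :: "real \<Rightarrow> (real^'n) set \<Rightarrow> 'n::finite point set \<Rightarrow>
    (real^'n \<Rightarrow> real) \<Rightarrow> real^'n \<Rightarrow> 'n point set" where
  "refractor_map \<kappa> \<Omega> S u x0 = {Y\<in>S. \<forall>x\<in>\<Omega>. u x \<le> phi \<kappa> x Y (x0, u x0)}"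

definition parallel_refractor :: "real \<Rightarrow> real \<Rightarrow> (real^'n) set \<Rightarrow> 'n::finite point set \<Rightarrow>
    (real^'n \<Rightarrow> real) \<Rightarrow> bool" where
  "parallel_refractor \<kappa> M0 \<Omega> S u \<longleftrightarrow>
    (\<forall>x\<in>\<Omega>. u x \<in> {0..M0}) \<and> (\<forall>x0\<in>\<Omega>. refractor_map \<kappa> \<Omega> S u x0 \<noteq> {})"

definition tracing :: "real \<Rightarrow> (real^'n) set \<Rightarrow> 'n::finite point set \<Rightarrow>
    (real^'n \<Rightarrow> real) \<Rightarrow> 'n point set \<Rightarrow> (real^'n) set" where
  "tracing \<kappa> \<Omega> S u E = {x\<in>\<Omega>. refractor_map \<kappa> \<Omega> S u x \<inter> E \<noteq> {}}"

definition source_measure :: "(real^'n) set \<Rightarrow> (real^'n \<Rightarrow> real) \<Rightarrow> (real^'n::finite) measure" where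
  "source_measure \<Omega> f = density (lebesgue_on \<Omega>) (\<lambda>x. ennreal (f x))"

text \<open>The Borel subsets of the target are the elements of \<open>sets \<sigma>\<close>. Since \<open>emeasure\<close> is \<open>0\<close> on
  non-measurable sets, measurability of the preimage is made explicit.\<close>

definition refractor_solution :: "real \<Rightarrow> (real^'n) set \<Rightarrow> 'n::finite point set \<Rightarrow>
    (real^'n \<Rightarrow> real) \<Rightarrow> 'n point measure \<Rightarrow> (real^'n \<Rightarrow> real) \<Rightarrow> bool" where
  "refractor_solution \<kappa> \<Omega> S f \<sigma> u \<longleftrightarrow> (\<forall>E\<in>sets \<sigma>.
      tracing \<kappa> \<Omega> S u E \<in> sets (source_measure \<Omega> f) \<and>
      emeasure (source_measure \<Omega> f) (tracing \<kappa> \<Omega> S u E) = emeasure \<sigma> E)"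

definition tangent_plane :: "(real^'n \<Rightarrow> real) \<Rightarrow> 'n::finite point \<Rightarrow> 'n point set" where
  "tangent_plane \<psi> Y = {(y, t). t = \<psi> (fst Y) + gradient \<psi> (fst Y) \<bullet> (y - fst Y)}"

text \<open>\<open>C\<^sup>1\<^sup>,\<^sup>\<alpha>\<close> with constant \<open>C\<close>: differentiable with Hoelder continuous gradient.\<close>

definition C1_alpha_on :: "real \<Rightarrow> real \<Rightarrow> 'a::real_inner set \<Rightarrow> ('a \<Rightarrow> real) \<Rightarrow> bool" where
  "C1_alpha_on \<alpha> C B u \<longleftrightarrow> (\<exists>Du. (\<forall>x\<in>B. GDERIV u x :> Du x) \<and>
      (\<forall>x\<in>B. \<forall>x'\<in>B. norm (Du x - Du x') \<le> C * norm (x - x') powr \<alpha>))"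

end

theory Submission
  imports Defs
begin

text \<open>Ellipsoids of eccentricity \<open>\<kappa>\<close> with vertical axis become spheres after a vertical
  rescaling. After an inversion at a common point \<open>Z\<close> they become hyperplanes, so the local
  comparison of ellipsoids in the regularity hypothesis is equivalent to a concavity
  inequality for their curvatures along the curve \<open>Y\<^sub>Z(\<lambda>)\<close>, and that inequality gives the comparison
  globally. Let the ellipsoids supporting \<open>u\<close> at two points at distance \<open>d\<close>, with
  foci at distance \<open>D \<ge> d\<close>, cross at \<open>Z\<close>. Then the graph of \<open>u\<close> passes within \<open>O(d D)\<close> below \<open>Z\<close>, and
  every target point within \<open>\<rho> = D\<^sup>3\<^sup>/\<^sup>2 d\<^sup>1\<^sup>/\<^sup>2\<close> of the middle part of the curve from \<open>Z\<close> can be seen only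
  from points within \<open>\<eta> = O((d / D)\<^sup>1\<^sup>/\<^sup>2)\<close> of \<open>Z\<close>. Comparing the mass \<open>\<ge> c \<rho>\<^sup>n\<^sup>-\<^sup>1 D\<close> of the tube with the
  mass \<open>\<le> C \<eta>\<^sup>n\<^sup>/\<^sup>q\<close> of the ball gives \<open>D = O(d\<^sup>\<alpha>)\<close>.\<close>

section \<open>Ellipsoids\<close>

text \<open>The powers of rho and eta come from a balance of three terms. At a graph point at
  distance h from Z that sees a target within rho of the curve, regularity yields a gain of order
  D^2 h^2, while moving from the curve to that target costs order rho h, and the gap between Z and
  the graph costs order d D. The three have equal order when h = (d / D)^(1/2) and rho = D^2 h. The
  mass comparison then bounds D^(1 + 3(n-1)/2) d^((n-1)/2) by (d / D)^(n/(2q)) up to a constant, and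
  collecting powers gives \<alpha>; p > n says n/q > n - 1, that is, \<alpha> > 0. The obstacle is
  locality: regularity compares ellipsoids only for x near Z, while points seeing the tube could a
  priori lie anywhere in \<Omega>. A curvature inequality has no x in it. No differentiability of u
  is available beforehand, so the estimate is proved for every choice of Y in \<open>F x\<close>.
  Differentiability comes last: each such Y gives a quadratic upper bound for u with linear part
  \<open>slope\<close>, and once these slopes are Hoelder continuous they are gradients.\<close>

text \<open>Below, \<open>P\<close> stands for \<open>Y - Z\<close> and \<open>\<xi>\<close> for \<open>X - Z\<close>. The ellipsoid with focus \<open>Y\<close> through
  \<open>Z\<close> is the zero set of \<open>\<xi> \<mapsto> defect \<kappa> P \<xi>\<close>, and \<open>slope \<kappa> P\<close> is the gradient of \<open>phi\<close> at the base point.\<close>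

definition depth :: "real \<Rightarrow> 'n::finite point \<Rightarrow> real" where
  "depth \<kappa> P = snd P - \<kappa> * norm P"

definition slope :: "real \<Rightarrow> 'n::finite point \<Rightarrow> real^'n" where
  "slope \<kappa> P = - (fst P /\<^sub>R depth \<kappa> P)"

definition curv :: "real \<Rightarrow> 'n::finite point \<Rightarrow> real" where
  "curv \<kappa> P = 1 / (2 * depth \<kappa> P)"

text \<open>Squared norm after scaling the last coordinate by sqrt (1 - \<kappa>^2); in these
  coordinates the ellipsoids are spheres.\<close>

definition qform :: "real \<Rightarrow> 'n::finite point \<Rightarrow> real" where
  "qform \<kappa> \<xi> = (norm (fst \<xi>))\<^sup>2 + (1 - \<kappa>\<^sup>2) * (snd \<xi>)\<^sup>2"

definition defect :: "real \<Rightarrow> 'n::finite point \<Rightarrow> 'n point \<Rightarrow> real" where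
  "defect \<kappa> P \<xi> = curv \<kappa> P * qform \<kappa> \<xi> - snd \<xi> + slope \<kappa> P \<bullet> fst \<xi>"

section \<open>The defect as position relative to an ellipsoid\<close>

lemma norm_point_sq: "(norm (P :: 'n::finite point))\<^sup>2 = (norm (fst P))\<^sup>2 + (snd P)\<^sup>2"
  by (simp add: norm_prod_def)

lemma abs_snd_le_norm: "\<bar>snd (P :: 'n::finite point)\<bar> \<le> norm P"
  by (metis norm_snd_le prod.collapse real_norm_def)

lemma norm_fst_le_norm: "norm (fst (P :: 'n::finite point)) \<le> norm P"
  by (metis norm_fst_le prod.collapse)

lemma defect_scaled:
  assumes "depth \<kappa> P \<noteq> 0"
  shows "2 * depth \<kappa> P * defect \<kappa> P \<xi>
    = qform \<kappa> \<xi> - 2 * (depth \<kappa> P * snd \<xi> + fst P \<bullet> fst \<xi>)"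
proof -
  have "depth \<kappa> P * (slope \<kappa> P \<bullet> fst \<xi>) = - (fst P \<bullet> fst \<xi>)"
    using assms by (simp add: slope_def)
  moreover have "2 * depth \<kappa> P * (curv \<kappa> P * qform \<kappa> \<xi>) = qform \<kappa> \<xi>"
    using assms by (simp add: curv_def)
  ultimately show ?thesis
    unfolding defect_def distrib_left right_diff_distrib by linarith
qed

lemma qform_le: "0 \<le> \<kappa> \<Longrightarrow> \<kappa> < 1 \<Longrightarrow> qform \<kappa> \<xi> \<le> (norm \<xi>)\<^sup>2"
  by (simp add: qform_def norm_point_sq algebra_simps)

lemma qform_ge:
  assumes "0 \<le> \<kappa>" "\<kappa> < 1"
  shows "(1 - \<kappa>\<^sup>2) * (norm \<xi>)\<^sup>2 \<le> qform \<kappa> \<xi>"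
proof -
  have "(1 - \<kappa>\<^sup>2) * (norm (fst \<xi>))\<^sup>2 \<le> (norm (fst \<xi>))\<^sup>2"
    by (simp add: algebra_simps)
  then show ?thesis
    by (simp add: qform_def norm_point_sq distrib_left)
qed

lemma qform_nonneg: "0 \<le> \<kappa> \<Longrightarrow> \<kappa> < 1 \<Longrightarrow> 0 \<le> qform \<kappa> \<xi>"
  by (simp add: qform_def abs_square_le_1)

text \<open>A difference of two squares: with d = |X - Y|, r = |Y - Z| and \<tau> the height of X
  over Z, both sides equal d^2 - (r - \<kappa> \<tau>)^2. Where the depth and the last factor are
  positive, the sign of the defect tells on which side of the ellipsoid through Z the point X lies;
  positive means outside.\<close>

lemma defect_cost:
  assumes "depth \<kappa> (Y - Z) \<noteq> 0"
  shows "2 * depth \<kappa> (Y - Z) * defect \<kappa> (Y - Z) (X - Z)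
    = (cost \<kappa> X Y - cost \<kappa> Z Y) * (norm (X - Y) + cost \<kappa> Z Y + \<kappa> * (snd Y - snd X))"
proof -
  define a p where "a = fst X - fst Z" and "p = fst Y - fst Z"
  define \<tau> e where "\<tau> = snd X - snd Z" and "e = snd Y - snd Z"
  define d r where "d = norm (X - Y)" and "r = norm (Y - Z)"
  have ap: "fst X - fst Y = a - p" by (simp add: a_def p_def)
  have d2: "d\<^sup>2 = a \<bullet> a - 2 * (a \<bullet> p) + p \<bullet> p + (\<tau> - e)\<^sup>2"
    unfolding d_def norm_point_sq fst_diff ap power2_norm_eq_inner
    by (simp add: \<tau>_def e_def inner_diff inner_commute algebra_simps)
  have r2: "r\<^sup>2 = p \<bullet> p + e\<^sup>2"
    unfolding r_def norm_point_sq by (simp add: p_def e_def power2_norm_eq_inner)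
  have cX: "cost \<kappa> X Y = d + \<kappa> * (\<tau> - e)" by (simp add: cost_def d_def \<tau>_def e_def)
  have cZ: "cost \<kappa> Z Y = r - \<kappa> * e"
    by (simp add: cost_def r_def e_def norm_minus_commute algebra_simps)
  have "2 * depth \<kappa> (Y - Z) * defect \<kappa> (Y - Z) (X - Z)
      = a \<bullet> a + (1 - \<kappa>\<^sup>2) * \<tau>\<^sup>2 - 2 * ((e - \<kappa> * r) * \<tau> + p \<bullet> a)"
    unfolding defect_scaled[OF assms] qform_def power2_norm_eq_inner
    by (simp add: depth_def a_def p_def \<tau>_def e_def r_def)
  also have "\<dots> = d\<^sup>2 - (r - \<kappa> * \<tau>)\<^sup>2"
  proof -
    have "(r - \<kappa> * \<tau>)\<^sup>2 = (p \<bullet> p + e\<^sup>2) - 2 * r * \<kappa> * \<tau> + \<kappa>\<^sup>2 * \<tau>\<^sup>2"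
      by (simp add: power2_diff r2 power_mult_distrib)
    then show ?thesis
      unfolding d2 by (simp add: power2_diff inner_commute algebra_simps)
  qed
  also have "\<dots> = (cost \<kappa> X Y - cost \<kappa> Z Y) * (d + cost \<kappa> Z Y + \<kappa> * (snd Y - snd X))"
  proof -
    have "snd Y - snd X = e - \<tau>" by (simp add: e_def \<tau>_def)
    show ?thesis unfolding cX cZ \<open>snd Y - snd X = e - \<tau>\<close>
      by (simp add: algebra_simps power2_eq_square)
  qed
  finally show ?thesis by (simp add: d_def)
qed

section \<open>Cost, depth and the lower half of an ellipsoid\<close>

lemma cost_eq: "cost \<kappa> X Y = norm (Y - X) - \<kappa> * snd (Y - X)"
  by (simp add: cost_def norm_minus_commute algebra_simps)

text \<open>At the base point the radicand in \<open>phi\<close> is the square of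
  \<open>depth \<kappa> (Y - X) / (1 - \<kappa>\<^sup>2)\<close>.\<close>

lemma depth_sq:
  "(depth \<kappa> (Y - X))\<^sup>2 = (cost \<kappa> X Y)\<^sup>2 - (1 - \<kappa>\<^sup>2) * (norm (fst X - fst Y))\<^sup>2"
proof -
  have "(norm (fst X - fst Y))\<^sup>2 = (norm (Y - X))\<^sup>2 - (snd (Y - X))\<^sup>2"
    by (simp add: norm_point_sq norm_minus_commute power2_commute)
  moreover have "(e - \<kappa> * r)\<^sup>2 = (r - \<kappa> * e)\<^sup>2 - (1 - \<kappa>\<^sup>2) * (r\<^sup>2 - e\<^sup>2)" for e r :: real
    by (simp add: algebra_simps power2_eq_square)
  ultimately show ?thesis
    unfolding depth_def cost_eq by metis
qed

text \<open>The cost is convex in its first argument, with vertical derivative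
  \<open>- depth \<kappa> (Y - X) / norm (Y - X)\<close> at \<open>X\<close>.\<close>

lemma cost_steep:
  fixes X X0 Y :: "'n::finite point"
  assumes k: "\<kappa> < 1" "depth \<kappa> (Y - X) \<ge> \<gamma> * norm (Y - X)" and g: "0 < \<gamma>" "Y \<noteq> X"
    and le: "cost \<kappa> X0 Y \<le> cost \<kappa> X Y"
  shows "snd X - snd X0 \<le> norm (fst X - fst X0) / \<gamma>"
proof (cases "snd X \<le> snd X0")
  case True
  then show ?thesis using g by (smt (verit) divide_nonneg_pos norm_ge_zero)
next
  case False
  define r where "r = norm (Y - X)"
  have r: "r > 0" using g by (simp add: r_def)
  \<comment> \<open>Cauchy-Schwarz is here the gradient inequality of the convex norm at Y -
    X.\<close>
  have "(Y - X0) \<bullet> (Y - X) \<le> norm (Y - X0) * r"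
    unfolding r_def by (rule norm_cauchy_schwarz)
  moreover have "(Y - X0) \<bullet> (Y - X) = r\<^sup>2 + (X - X0) \<bullet> (Y - X)"
    unfolding r_def power2_norm_eq_inner by (simp add: inner_diff algebra_simps)
  ultimately have cs: "r\<^sup>2 + (X - X0) \<bullet> (Y - X) \<le> norm (Y - X0) * r" by simp
  have "norm (Y - X0) - r \<le> \<kappa> * (snd X - snd X0)"
    using le unfolding cost_eq r_def by (simp add: algebra_simps)
  then have "(norm (Y - X0) - r) * r \<le> \<kappa> * (snd X - snd X0) * r"
    using r by (intro mult_right_mono) auto
  with cs have 1: "(X - X0) \<bullet> (Y - X) \<le> \<kappa> * (snd X - snd X0) * r"
    by (simp add: algebra_simps power2_eq_square)
  have "(X - X0) \<bullet> (Y - X) = (fst X - fst X0) \<bullet> fst (Y - X) + (snd X - snd X0) * snd (Y - X)"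
    by (simp add: inner_prod_def)
  with 1 have "(snd X - snd X0) * depth \<kappa> (Y - X) \<le> - ((fst X - fst X0) \<bullet> fst (Y - X))"
    unfolding depth_def r_def by (simp add: algebra_simps)
  also have "\<dots> \<le> norm (fst X - fst X0) * norm (fst (Y - X))"
    by (metis abs_le_D2 Cauchy_Schwarz_ineq2)
  also have "\<dots> \<le> norm (fst X - fst X0) * r"
    unfolding r_def by (intro mult_left_mono norm_fst_le_norm) auto
  finally have "(snd X - snd X0) * depth \<kappa> (Y - X) \<le> norm (fst X - fst X0) * r" .
  moreover have "(snd X - snd X0) * (\<gamma> * r) \<le> (snd X - snd X0) * depth \<kappa> (Y - X)"
    using False k unfolding r_def by (intro mult_left_mono) auto
  ultimately have "((snd X - snd X0) * \<gamma>) * r \<le> norm (fst X - fst X0) * r"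
    by (simp add: mult.assoc)
  then have "(snd X - snd X0) * \<gamma> \<le> norm (fst X - fst X0)"
    using r by simp
  then show ?thesis using g by (simp add: pos_le_divide_eq)
qed

text \<open>Clearing the denominator leaves a square root against an affine function of t, ready to
  be squared.\<close>

lemma le_phi_iff:
  fixes X0 Y :: "'n::finite point" and x :: "real^'n"
  assumes k: "0 < \<kappa>" "\<kappa> < 1"
  defines "b \<equiv> cost \<kappa> X0 Y"
  shows "t \<le> phi \<kappa> x Y X0 \<longleftrightarrow>
    sqrt (b\<^sup>2 - (1 - \<kappa>\<^sup>2) * (norm (x - fst Y))\<^sup>2) \<le> (1 - \<kappa>\<^sup>2) * (snd Y - t) - \<kappa> * b"
    and "phi \<kappa> x Y X0 \<le> t \<longleftrightarrow>
    sqrt (b\<^sup>2 - (1 - \<kappa>\<^sup>2) * (norm (x - fst Y))\<^sup>2) \<ge> (1 - \<kappa>\<^sup>2) * (snd Y - t) - \<kappa> * b"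
proof -
  define w where "w = 1 - \<kappa>\<^sup>2"
  have w: "w > 0" using k by (simp add: w_def abs_square_less_1)
  have "b\<^sup>2 / w\<^sup>2 - (norm (x - fst Y))\<^sup>2 / w = (b\<^sup>2 - w * (norm (x - fst Y))\<^sup>2) / w\<^sup>2"
    using w by (simp add: field_simps power2_eq_square)
  then have "sqrt (b\<^sup>2 / w\<^sup>2 - (norm (x - fst Y))\<^sup>2 / w)
      = sqrt (b\<^sup>2 - w * (norm (x - fst Y))\<^sup>2) / w"
    using w by (simp add: real_sqrt_divide)
  then have ph: "phi \<kappa> x Y X0 = snd Y - (\<kappa> * b + sqrt (b\<^sup>2 - w * (norm (x - fst Y))\<^sup>2)) / w"
    unfolding phi_def b_def[symmetric] w_def[symmetric] by (simp add: add_divide_distrib)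
  show "t \<le> phi \<kappa> x Y X0 \<longleftrightarrow>
    sqrt (b\<^sup>2 - (1 - \<kappa>\<^sup>2) * (norm (x - fst Y))\<^sup>2) \<le> (1 - \<kappa>\<^sup>2) * (snd Y - t) - \<kappa> * b"
    unfolding ph w_def[symmetric] using w by (auto simp: field_simps)
  show "phi \<kappa> x Y X0 \<le> t \<longleftrightarrow>
    sqrt (b\<^sup>2 - (1 - \<kappa>\<^sup>2) * (norm (x - fst Y))\<^sup>2) \<ge> (1 - \<kappa>\<^sup>2) * (snd Y - t) - \<kappa> * b"
    unfolding ph w_def[symmetric] using w by (auto simp: field_simps)
qed

text \<open>Two equations of one ellipsoid. The right side is the focal form,
  \<open>norm (X - Y) = b + \<kappa> * (snd Y - snd X)\<close>, squared; the left side is the same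
  quadratic with the square completed in the height, as it arises from squaring
  \<open>le_phi_iff\<close>.\<close>

lemma ellipsoid_eq:
  fixes X Y :: "'n::finite point"
  shows "((1 - \<kappa>\<^sup>2) * (snd Y - snd X) - \<kappa> * b)\<^sup>2 - (b\<^sup>2 - (1 - \<kappa>\<^sup>2) * (norm (fst X - fst Y))\<^sup>2)
    = (1 - \<kappa>\<^sup>2) * ((norm (X - Y))\<^sup>2 - (b + \<kappa> * (snd Y - snd X))\<^sup>2)"
proof -
  have "(norm (fst X - fst Y))\<^sup>2 = (norm (X - Y))\<^sup>2 - (snd Y - snd X)\<^sup>2"
    by (simp add: norm_point_sq power2_commute)
  moreover have "((1 - \<kappa>\<^sup>2) * e - \<kappa> * b)\<^sup>2 - (b\<^sup>2 - (1 - \<kappa>\<^sup>2) * (d\<^sup>2 - e\<^sup>2))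
      = (1 - \<kappa>\<^sup>2) * (d\<^sup>2 - (b + \<kappa> * e)\<^sup>2)" for e d :: real
    by (simp add: algebra_simps power2_eq_square)
  ultimately show ?thesis by metis
qed

lemma cost_ge_of_le_phi:
  fixes X X0 Y :: "'n::finite point"
  assumes k: "0 < \<kappa>" "\<kappa> < 1"
    and le: "snd X \<le> phi \<kappa> (fst X) Y X0"
  shows "cost \<kappa> X0 Y \<le> cost \<kappa> X Y"
proof -
  define b where "b = cost \<kappa> X0 Y"
  have w: "1 - \<kappa>\<^sup>2 > 0" using k by (simp add: abs_square_less_1)
  have "sqrt (b\<^sup>2 - (1 - \<kappa>\<^sup>2) * (norm (fst X - fst Y))\<^sup>2) \<le> (1 - \<kappa>\<^sup>2) * (snd Y - snd X) - \<kappa> * b"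
    using le le_phi_iff(1)[OF k] unfolding b_def by blast
  then have "b\<^sup>2 - (1 - \<kappa>\<^sup>2) * (norm (fst X - fst Y))\<^sup>2 \<le> ((1 - \<kappa>\<^sup>2) * (snd Y - snd X) - \<kappa> * b)\<^sup>2"
    by (rule sqrt_le_D)
  then have "0 \<le> (1 - \<kappa>\<^sup>2) * ((norm (X - Y))\<^sup>2 - (b + \<kappa> * (snd Y - snd X))\<^sup>2)"
    using ellipsoid_eq[of \<kappa> Y X b] by linarith
  then have "(b + \<kappa> * (snd Y - snd X))\<^sup>2 \<le> (norm (X - Y))\<^sup>2"
    using w by (simp add: zero_le_mult_iff)
  then have "b + \<kappa> * (snd Y - snd X) \<le> norm (X - Y)"
    by (rule power2_le_imp_le) simp
  then show ?thesis unfolding b_def by (simp add: cost_def algebra_simps)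
qed

text \<open>Nonnegative depth says that X lies on the lower half of its ellipsoid, the half that
  \<open>phi\<close> parametrizes.\<close>

lemma phi_base:
  assumes k: "0 < \<kappa>" "\<kappa> < 1" and d: "0 \<le> depth \<kappa> (Y - X)"
  shows "phi \<kappa> (fst X) Y X = snd X"
proof -
  have "sqrt ((cost \<kappa> X Y)\<^sup>2 - (1 - \<kappa>\<^sup>2) * (norm (fst X - fst Y))\<^sup>2) = depth \<kappa> (Y - X)"
    unfolding depth_sq[symmetric] using d by simp
  also have "\<dots> = (1 - \<kappa>\<^sup>2) * (snd Y - snd X) - \<kappa> * cost \<kappa> X Y"
    by (simp add: depth_def cost_eq algebra_simps power2_eq_square)
  finally show ?thesis
    using le_phi_iff[OF k, where x = "fst X" and Y = Y and ?X0.0 = X]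
    by (metis order_antisym order_refl)
qed

lemma phi_graph:
  fixes Z X0 Y :: "'n::finite point"
  assumes k: "0 < \<kappa>" "\<kappa> < 1" and b: "0 \<le> cost \<kappa> X0 Y"
    and inside: "(1 - \<kappa>\<^sup>2) * (norm (fst Z - fst Y))\<^sup>2 \<le> (cost \<kappa> X0 Y)\<^sup>2"
    and Z: "snd Z = phi \<kappa> (fst Z) Y X0"
  shows "cost \<kappa> Z Y = cost \<kappa> X0 Y" "0 \<le> depth \<kappa> (Y - Z)"
proof -
  define b where "b = cost \<kappa> X0 Y"
  have b0: "b \<ge> 0" using b by (simp add: b_def)
  have w: "1 - \<kappa>\<^sup>2 > 0" using k by (simp add: abs_square_less_1)
  have eq: "sqrt (b\<^sup>2 - (1 - \<kappa>\<^sup>2) * (norm (fst Z - fst Y))\<^sup>2) = (1 - \<kappa>\<^sup>2) * (snd Y - snd Z) - \<kappa> * b"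
    using Z le_phi_iff[OF k] unfolding b_def by (metis order_antisym order_refl)
  then have sq: "b\<^sup>2 - (1 - \<kappa>\<^sup>2) * (norm (fst Z - fst Y))\<^sup>2 = ((1 - \<kappa>\<^sup>2) * (snd Y - snd Z) - \<kappa> * b)\<^sup>2"
    using inside unfolding b_def[symmetric]
    by (metis diff_ge_0_iff_ge real_sqrt_pow2)
  have nn: "0 \<le> (1 - \<kappa>\<^sup>2) * (snd Y - snd Z) - \<kappa> * b"
    unfolding eq[symmetric] using inside unfolding b_def[symmetric] by simp
  then have "0 \<le> (1 - \<kappa>\<^sup>2) * (snd Y - snd Z)" using k b0 by (smt (verit) mult_nonneg_nonneg)
  then have e: "0 \<le> snd Y - snd Z" using w by (simp add: zero_le_mult_iff)
  have "(1 - \<kappa>\<^sup>2) * ((norm (Z - Y))\<^sup>2 - (b + \<kappa> * (snd Y - snd Z))\<^sup>2) = 0"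
    using ellipsoid_eq[of \<kappa> Y Z b] sq by linarith
  then have "(norm (Z - Y))\<^sup>2 = (b + \<kappa> * (snd Y - snd Z))\<^sup>2" using w by simp
  then have n: "norm (Z - Y) = b + \<kappa> * (snd Y - snd Z)"
    by (rule power2_eq_imp_eq) (use e b0 k in auto)
  then show c: "cost \<kappa> Z Y = cost \<kappa> X0 Y"
    unfolding b_def[symmetric] by (simp add: cost_def algebra_simps)
  have "depth \<kappa> (Y - Z) = (1 - \<kappa>\<^sup>2) * (snd Y - snd Z) - \<kappa> * b"
    unfolding depth_def norm_minus_commute[of Y] n by (simp add: algebra_simps power2_eq_square)
  then show "0 \<le> depth \<kappa> (Y - Z)" using nn by simp
qed

text \<open>A nonnegative defect means outside the ellipsoid, which includes the region above it.
  The height bound in the second part keeps X below the centre, where outside means below the graph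
  of \<open>phi\<close>.\<close>

lemma le_phi_defect:
  fixes X Y Z :: "'n::finite point"
  assumes k: "0 < \<kappa>" "\<kappa> < 1" and d: "0 < depth \<kappa> (Y - Z)"
  shows "snd X \<le> phi \<kappa> (fst X) Y Z \<Longrightarrow> 0 \<le> defect \<kappa> (Y - Z) (X - Z)"
    and "\<lbrakk>0 \<le> defect \<kappa> (Y - Z) (X - Z); (1 - \<kappa>\<^sup>2) * snd (X - Z) \<le> depth \<kappa> (Y - Z)\<rbrakk>
      \<Longrightarrow> snd X \<le> phi \<kappa> (fst X) Y Z"
proof -
  define b where "b = cost \<kappa> Z Y"
  define E where "E = (1 - \<kappa>\<^sup>2) * (snd Y - snd X) - \<kappa> * b"
  define B where "B = b\<^sup>2 - (1 - \<kappa>\<^sup>2) * (norm (fst X - fst Y))\<^sup>2"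
  have w: "1 - \<kappa>\<^sup>2 > 0" using k by (simp add: abs_square_less_1)
  have E: "E = depth \<kappa> (Y - Z) - (1 - \<kappa>\<^sup>2) * snd (X - Z)"
    unfolding E_def b_def depth_def cost_eq by (simp add: algebra_simps power2_eq_square)
  have "E\<^sup>2 - B = (1 - \<kappa>\<^sup>2) * ((norm (X - Y))\<^sup>2 - (b + \<kappa> * (snd Y - snd X))\<^sup>2)"
    unfolding E_def B_def by (rule ellipsoid_eq)
  also have "(norm (X - Y))\<^sup>2 - (b + \<kappa> * (snd Y - snd X))\<^sup>2
      = (cost \<kappa> X Y - b) * (norm (X - Y) + b + \<kappa> * (snd Y - snd X))"
    unfolding cost_def by (simp add: algebra_simps power2_eq_square)
  also have "\<dots> = 2 * depth \<kappa> (Y - Z) * defect \<kappa> (Y - Z) (X - Z)"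
    unfolding b_def using d by (intro defect_cost[symmetric]) simp
  finally have "E\<^sup>2 - B = (1 - \<kappa>\<^sup>2) * (2 * depth \<kappa> (Y - Z)) * defect \<kappa> (Y - Z) (X - Z)"
    by simp
  moreover have "0 < (1 - \<kappa>\<^sup>2) * (2 * depth \<kappa> (Y - Z))" using w d by simp
  ultimately have iff: "B \<le> E\<^sup>2 \<longleftrightarrow> 0 \<le> defect \<kappa> (Y - Z) (X - Z)"
    by (smt (verit) mult_nonneg_nonneg mult_pos_neg)
  have phi: "snd X \<le> phi \<kappa> (fst X) Y Z \<longleftrightarrow> sqrt B \<le> E"
    unfolding B_def E_def b_def by (rule le_phi_iff(1)[OF k])
  show "0 \<le> defect \<kappa> (Y - Z) (X - Z)" if "snd X \<le> phi \<kappa> (fst X) Y Z"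
    using that iff phi sqrt_le_D by blast
  show "snd X \<le> phi \<kappa> (fst X) Y Z"
    if "0 \<le> defect \<kappa> (Y - Z) (X - Z)" "(1 - \<kappa>\<^sup>2) * snd (X - Z) \<le> depth \<kappa> (Y - Z)"
    using that iff phi E real_le_lsqrt[of E B] by simp
qed

text \<open>On this set \<open>curv\<close> and \<open>slope\<close> are bounded and Lipschitz with
  constants depending only on \<gamma> and R, although the set is unbounded.\<close>

definition steep_cone :: "real \<Rightarrow> real \<Rightarrow> real \<Rightarrow> 'n::finite point set" where
  "steep_cone \<kappa> \<gamma> R = {P. \<gamma> * norm P \<le> depth \<kappa> P \<and> R \<le> norm P}"

lemma depth_lipschitz:
  assumes "0 < \<kappa>" "\<kappa> < 1"
  shows "\<bar>depth \<kappa> P - depth \<kappa> P'\<bar> \<le> 2 * norm (P - P')"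
proof -
  have "\<bar>snd P - snd P'\<bar> \<le> norm (P - P')"
    using abs_snd_le_norm[of "P - P'"] by simp
  moreover have "\<bar>\<kappa> * (norm P - norm P')\<bar> \<le> 1 * norm (P - P')"
    unfolding abs_mult by (intro mult_mono norm_triangle_ineq3) (use assms in auto)
  ultimately show ?thesis
    unfolding depth_def by (simp add: right_diff_distrib)
qed

lemma depth_cone:
  assumes "P \<in> steep_cone \<kappa> \<gamma> R" "0 < \<gamma>" "0 < R"
  shows "\<gamma> * R \<le> depth \<kappa> P" "0 < depth \<kappa> P" "norm P / depth \<kappa> P \<le> 1 / \<gamma>"
proof -
  have "\<gamma> * R \<le> \<gamma> * norm P" using assms by (simp add: steep_cone_def)
  then show 1: "\<gamma> * R \<le> depth \<kappa> P" using assms(1) unfolding steep_cone_def by simp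
  then show 2: "0 < depth \<kappa> P" using assms by (smt (verit) mult_pos_pos)
  show "norm P / depth \<kappa> P \<le> 1 / \<gamma>"
    using assms 2 by (simp add: steep_cone_def field_simps)
qed

lemma curv_cone:
  assumes "P \<in> steep_cone \<kappa> \<gamma> R" "0 < \<gamma>" "0 < R"
  shows "0 < curv \<kappa> P" "curv \<kappa> P \<le> 1 / (2 * (\<gamma> * R))"
  using depth_cone[OF assms] assms by (auto simp: curv_def intro!: divide_left_mono)

lemma norm_slope_cone:
  assumes "P \<in> steep_cone \<kappa> \<gamma> R" "0 < \<gamma>" "0 < R"
  shows "norm (slope \<kappa> P) \<le> 1 / \<gamma>"
proof -
  have "norm (slope \<kappa> P) = norm (fst P) / depth \<kappa> P"
    using depth_cone[OF assms] by (simp add: slope_def divide_inverse mult.commute)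
  also have "\<dots> \<le> norm P / depth \<kappa> P"
    using depth_cone[OF assms] by (intro divide_right_mono norm_fst_le_norm) auto
  finally show ?thesis using depth_cone[OF assms] by simp
qed

text \<open>The factor \<open>depth \<kappa> P'\<close> is kept because P' may be large: for
  \<open>curv\<close> it is bounded below by \<gamma> R, and for \<open>slope\<close> it compensates
  the factor \<open>norm P'\<close>.\<close>

lemma inverse_depth_lipschitz:
  assumes "P \<in> steep_cone \<kappa> \<gamma> R" "P' \<in> steep_cone \<kappa> \<gamma> R" "0 < \<gamma>" "0 < R" "0 < \<kappa>" "\<kappa> < 1"
  shows "\<bar>1 / depth \<kappa> P - 1 / depth \<kappa> P'\<bar> * depth \<kappa> P' \<le> 2 * norm (P - P') / (\<gamma> * R)"
proof -
  note d = depth_cone[OF assms(1,3,4)] and d' = depth_cone[OF assms(2-4)]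
  have "(1 / depth \<kappa> P - 1 / depth \<kappa> P') * depth \<kappa> P' = (depth \<kappa> P' - depth \<kappa> P) / depth \<kappa> P"
    using d d' by (simp add: field_simps)
  then have "\<bar>1 / depth \<kappa> P - 1 / depth \<kappa> P'\<bar> * depth \<kappa> P' = \<bar>depth \<kappa> P - depth \<kappa> P'\<bar> / depth \<kappa> P"
    using d d' by (metis abs_minus_commute abs_divide abs_mult abs_of_pos)
  also have "\<dots> \<le> 2 * norm (P - P') / (\<gamma> * R)"
    using d(1) depth_lipschitz[OF assms(5,6), of P P'] assms(3,4) by (intro frac_le) auto
  finally show ?thesis .
qed

lemma curv_lipschitz:
  assumes "P \<in> steep_cone \<kappa> \<gamma> R" "P' \<in> steep_cone \<kappa> \<gamma> R" "0 < \<gamma>" "0 < R" "0 < \<kappa>" "\<kappa> < 1"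
  shows "\<bar>curv \<kappa> P - curv \<kappa> P'\<bar> \<le> norm (P - P') / (\<gamma> * R)\<^sup>2"
proof -
  note d' = depth_cone[OF assms(2-4)]
  have "curv \<kappa> P - curv \<kappa> P' = (1 / depth \<kappa> P - 1 / depth \<kappa> P') / 2"
    by (simp add: curv_def diff_divide_distrib)
  then have "2 * \<bar>curv \<kappa> P - curv \<kappa> P'\<bar> * (\<gamma> * R) = \<bar>1 / depth \<kappa> P - 1 / depth \<kappa> P'\<bar> * (\<gamma> * R)"
    by (simp only: abs_divide abs_numeral) simp
  also have "\<dots> \<le> \<bar>1 / depth \<kappa> P - 1 / depth \<kappa> P'\<bar> * depth \<kappa> P'"
    using d' by (intro mult_left_mono) auto
  also have "\<dots> \<le> 2 * norm (P - P') / (\<gamma> * R)"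
    by (rule inverse_depth_lipschitz[OF assms])
  finally show ?thesis
    using assms(3,4) by (simp add: field_simps power2_eq_square)
qed

lemma slope_lipschitz:
  assumes "P \<in> steep_cone \<kappa> \<gamma> R" "P' \<in> steep_cone \<kappa> \<gamma> R" "0 < \<gamma>" "0 < R" "0 < \<kappa>" "\<kappa> < 1"
  shows "norm (slope \<kappa> P - slope \<kappa> P') \<le> (1 / (\<gamma> * R) + 2 / (\<gamma>\<^sup>2 * R)) * norm (P - P')"
proof -
  note d = depth_cone[OF assms(1,3,4)] and d' = depth_cone[OF assms(2-4)]
  define a where "a = 1 / depth \<kappa> P - 1 / depth \<kappa> P'"
  have "slope \<kappa> P' - slope \<kappa> P = (1 / depth \<kappa> P) *\<^sub>R fst (P - P') + a *\<^sub>R fst P'"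
    by (simp add: slope_def a_def divide_inverse algebra_simps)
  then have "norm (slope \<kappa> P - slope \<kappa> P') \<le> \<bar>1 / depth \<kappa> P\<bar> * norm (fst (P - P')) + \<bar>a\<bar> * norm (fst P')"
    by (metis norm_minus_commute norm_triangle_ineq norm_scaleR)
  also have "\<bar>1 / depth \<kappa> P\<bar> * norm (fst (P - P')) \<le> 1 / (\<gamma> * R) * norm (P - P')"
    using d assms by (intro mult_mono norm_fst_le_norm) (auto intro!: divide_left_mono)
  also have "\<bar>a\<bar> * norm (fst P') \<le> 2 / (\<gamma>\<^sup>2 * R) * norm (P - P')"
  proof -
    have "\<bar>a\<bar> * norm (fst P') \<le> \<bar>a\<bar> * norm P'"
      by (intro mult_left_mono norm_fst_le_norm) auto
    also have "\<dots> = (\<bar>a\<bar> * depth \<kappa> P') * (norm P' / depth \<kappa> P')"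
      using d' by simp
    also have "\<dots> \<le> (2 * norm (P - P') / (\<gamma> * R)) * (1 / \<gamma>)"
      using d' inverse_depth_lipschitz[OF assms] assms unfolding a_def
      by (intro mult_mono) auto
    finally show ?thesis by (simp add: power2_eq_square field_simps)
  qed
  finally show ?thesis by (simp add: distrib_right)
qed

section \<open>Slopes as coordinates for directions\<close>

lemma Q_facts:
  assumes k: "0 < \<kappa>" "\<kappa> < 1"
  shows "0 < Q \<kappa> v" "(Q \<kappa> v)\<^sup>2 * (norm v)\<^sup>2 + (Q \<kappa> v + \<kappa>)\<^sup>2 = 1"
proof -
  define n where "n = (norm v)\<^sup>2"
  define s where "s = sqrt (1 + (1 - \<kappa>\<^sup>2) * n)"
  have n: "n \<ge> 0" by (simp add: n_def)
  have w: "1 - \<kappa>\<^sup>2 > 0" using k by (simp add: abs_square_less_1)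
  have s2: "s\<^sup>2 = 1 + (1 - \<kappa>\<^sup>2) * n" unfolding s_def using n w by simp
  have "s \<ge> 1" unfolding s_def using n w by simp
  have Q: "Q \<kappa> v = (s - \<kappa>) / (1 + n)" by (simp add: Q_def s_def n_def)
  show "0 < Q \<kappa> v" unfolding Q using \<open>s \<ge> 1\<close> k n by simp
  have q: "Q \<kappa> v * (1 + n) = s - \<kappa>" unfolding Q using n by simp
  \<comment> \<open>The claim is that \<open>Q \<kappa> v\<close> solves t^2 (1 + n) + 2 \<kappa> t
    + \<kappa>^2 = 1; the extra factor 1 + n lets fact \<open>q\<close> be substituted.\<close>
  have "(1 + n) * ((Q \<kappa> v)\<^sup>2 * n + (Q \<kappa> v + \<kappa>)\<^sup>2)
      = (Q \<kappa> v * (1 + n))\<^sup>2 + 2 * \<kappa> * (Q \<kappa> v * (1 + n)) + \<kappa>\<^sup>2 * (1 + n)"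
    by (simp add: algebra_simps power2_eq_square)
  also have "\<dots> = (1 + n) * 1"
    unfolding q using s2 by (simp add: algebra_simps power2_eq_square)
  finally show "(Q \<kappa> v)\<^sup>2 * (norm v)\<^sup>2 + (Q \<kappa> v + \<kappa>)\<^sup>2 = 1"
    unfolding n_def[symmetric] using n by (subst (asm) mult_cancel_left) auto
qed

lemma norm_Lam: "0 < \<kappa> \<Longrightarrow> \<kappa> < 1 \<Longrightarrow> norm (Lam \<kappa> v) = 1"
  using Q_facts(2)[of \<kappa> v] by (simp add: Lam_def norm_prod_def power_mult_distrib)

text \<open>Because \<open>Lam\<close> is a unit vector, the depth of r Lam(v) is r Q(v), so r
  cancels from the slope.\<close>

lemma slope_Lam:
  assumes "0 < \<kappa>" "\<kappa> < 1" "0 < r"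
  shows "slope \<kappa> (r *\<^sub>R Lam \<kappa> v) = v"
proof -
  define c where "c = r * Q \<kappa> v"
  have "c > 0" using assms Q_facts(1)[of \<kappa> v] by (simp add: c_def)
  moreover have "depth \<kappa> (r *\<^sub>R Lam \<kappa> v) = c"
    using assms by (simp add: depth_def norm_Lam) (simp add: c_def Lam_def algebra_simps)
  moreover have "fst (r *\<^sub>R Lam \<kappa> v) = - (c *\<^sub>R v)"
    by (simp add: c_def Lam_def)
  ultimately show ?thesis by (simp add: slope_def)
qed

lemma norm_scaleR_Lam_slope:
  assumes k: "0 < \<kappa>" "\<kappa> < 1" and d: "0 < depth \<kappa> P"
  shows "norm P *\<^sub>R Lam \<kappa> (slope \<kappa> P) = P"
proof -
  define v q r where "v = slope \<kappa> P" and "q = depth \<kappa> P / norm P" and "r = norm P"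
  have "P \<noteq> 0" using d by (auto simp: depth_def)
  then have r: "r > 0" by (simp add: r_def)
  have q: "q > 0" using d r by (simp add: q_def r_def)
  have rq: "depth \<kappa> P = r * q" using r by (simp add: q_def r_def)
  have fP: "fst P = - ((r * q) *\<^sub>R v)"
    unfolding rq[symmetric] using d by (simp add: v_def slope_def)
  have sP: "snd P = r * (q + \<kappa>)"
    using rq by (simp add: depth_def r_def algebra_simps)
  have "r\<^sup>2 = (norm (fst P))\<^sup>2 + (snd P)\<^sup>2"
    unfolding r_def by (rule norm_point_sq)
  then have "r\<^sup>2 * 1 = r\<^sup>2 * (q\<^sup>2 * (norm v)\<^sup>2 + (q + \<kappa>)\<^sup>2)"
    unfolding fP sP by (simp only: norm_minus_cancel norm_scaleR power_mult_distrib power2_abs)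
      (simp add: distrib_left mult.assoc)
  then have eq: "q\<^sup>2 * (norm v)\<^sup>2 + (q + \<kappa>)\<^sup>2 = 1" using r by simp
  \<comment> \<open>\<open>q\<close> and \<open>Q \<kappa> v\<close> are positive roots of the same
    quadratic; subtracting the two equations leaves a second factor that cannot vanish.\<close>
  have "(Q \<kappa> v - q) * ((Q \<kappa> v + q) * (1 + (norm v)\<^sup>2) + 2 * \<kappa>) = 0"
    using eq Q_facts(2)[OF k, of v] by (simp add: algebra_simps power2_eq_square)
  moreover have "(Q \<kappa> v + q) * (1 + (norm v)\<^sup>2) + 2 * \<kappa> > 0"
    using q Q_facts(1)[OF k, of v] k
    by (intro add_pos_pos[OF mult_pos_pos[OF add_pos_pos add_pos_nonneg]]) auto
  ultimately have "Q \<kappa> v = q" by simp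
  then show ?thesis
    unfolding v_def[symmetric] r_def[symmetric]
    by (simp add: Lam_def prod_eq_iff fP sP)
qed

lemma gradient_phi:
  fixes Y Z :: "'n::finite point"
  assumes k: "0 < \<kappa>" "\<kappa> < 1" and d: "0 < depth \<kappa> (Y - Z)"
  shows "gradient (\<lambda>x. phi \<kappa> x Y Z) (fst Z) = slope \<kappa> (Y - Z)"
proof -
  define w b z y K where "w = 1 - \<kappa>\<^sup>2" and "b = cost \<kappa> Z Y" and "z = fst Z" and "y = fst Y"
    and "K = depth \<kappa> (Y - Z)"
  have w: "w > 0" using k by (simp add: w_def abs_square_less_1)
  have K: "K > 0" using d by (simp add: K_def)
  have "K\<^sup>2 = b\<^sup>2 - w * (norm (z - y))\<^sup>2"
    unfolding K_def b_def w_def z_def y_def by (rule depth_sq)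
  \<comment> \<open>At the base point the radicand is a positive square, so \<open>sqrt\<close> is
    differentiable there.\<close>
  then have rad: "b\<^sup>2 / w\<^sup>2 - ((z - y) \<bullet> (z - y)) / w = (K / w)\<^sup>2"
    using w unfolding power2_norm_eq_inner by (simp add: field_simps power2_eq_square)
  have "((\<lambda>x. b\<^sup>2 / w\<^sup>2 - ((x - y) \<bullet> (x - y)) / w) has_derivative
      (\<lambda>h. - (2 * ((z - y) \<bullet> h)) / w)) (at z)"
    using w by (auto intro!: derivative_eq_intros simp: inner_commute)
  moreover have "(sqrt has_real_derivative inverse (sqrt ((K / w)\<^sup>2)) / 2)
      (at (b\<^sup>2 / w\<^sup>2 - ((z - y) \<bullet> (z - y)) / w))"
    unfolding rad using K w by (intro DERIV_real_sqrt) simp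
  ultimately have "((\<lambda>x. sqrt (b\<^sup>2 / w\<^sup>2 - ((x - y) \<bullet> (x - y)) / w)) has_derivative
      (\<lambda>h. (- (2 * ((z - y) \<bullet> h)) / w) * (inverse (sqrt ((K / w)\<^sup>2)) / 2))) (at z)"
    by (rule DERIV_compose_FDERIV[rotated])
  then have "((\<lambda>x. phi \<kappa> x Y Z) has_derivative
      (\<lambda>h. - ((- (2 * ((z - y) \<bullet> h)) / w) * (inverse (sqrt ((K / w)\<^sup>2)) / 2)))) (at z)"
    unfolding phi_def b_def[symmetric] w_def[symmetric] y_def[symmetric] power2_norm_eq_inner
    by (rule has_derivative_eq_rhs[OF has_derivative_diff[OF has_derivative_const]]) simp
  moreover have "slope \<kappa> (Y - Z) = (z - y) /\<^sub>R K"
    by (simp add: slope_def z_def y_def K_def scaleR_diff_right)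
  moreover have "- ((- (2 * ((z - y) \<bullet> h)) / w) * (inverse (sqrt ((K / w)\<^sup>2)) / 2)) = h \<bullet> ((z - y) /\<^sub>R K)" for h
  proof -
    have "- ((- (2 * a) / w) * (inverse (K / w) / 2)) = inverse K * a" for a
      using w K by (simp add: field_simps)
    moreover have "sqrt ((K / w)\<^sup>2) = K / w" using w K by simp
    ultimately show ?thesis by (simp only: inner_scaleR_right inner_commute)
  qed
  ultimately have G: "GDERIV (\<lambda>x. phi \<kappa> x Y Z) z :> slope \<kappa> (Y - Z)"
    unfolding gderiv_def by simp
  \<comment> \<open>\<open>gradient\<close> is a definite description, so uniqueness has to be shown
    as well.\<close>
  have "D = slope \<kappa> (Y - Z)" if "GDERIV (\<lambda>x. phi \<kappa> x Y Z) z :> D" for D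
  proof -
    have "(\<lambda>h. h \<bullet> D) = (\<lambda>h. h \<bullet> slope \<kappa> (Y - Z))"
      using that G unfolding gderiv_def by (rule has_derivative_unique)
    then show ?thesis by (metis inner_commute vector_eq_ldot)
  qed
  with G show ?thesis unfolding gradient_def z_def by blast
qed

section \<open>Admissible targets\<close>

text \<open>sqrt (1 - \<delta>0^2) is the lower bound for depth / cost and 1 - \<kappa> the one for
  cost / norm.\<close>

definition cone_bound :: "real \<Rightarrow> real \<Rightarrow> real" where
  "cone_bound \<kappa> \<delta>0 = (1 - \<kappa>) * sqrt (1 - \<delta>0\<^sup>2)"

lemma cone_bound_pos: "0 < \<kappa> \<Longrightarrow> \<kappa> < 1 \<Longrightarrow> 0 < \<delta>0 \<Longrightarrow> \<delta>0 < 1 \<Longrightarrow> 0 < cone_bound \<kappa> \<delta>0"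
  by (simp add: cone_bound_def abs_square_less_1)

lemma depth_ge_cone_bound:
  fixes X Y :: "'n::finite point"
  assumes k: "0 < \<kappa>" "\<kappa> < 1" and d: "0 < \<delta>0" "\<delta>0 < 1"
    and b: "0 \<le> cost \<kappa> X Y"
    and inside: "(1 - \<kappa>\<^sup>2) * (norm (fst X - fst Y))\<^sup>2 \<le> \<delta>0\<^sup>2 * (cost \<kappa> X Y)\<^sup>2"
    and nn: "0 \<le> depth \<kappa> (Y - X)"
  shows "cone_bound \<kappa> \<delta>0 * norm (Y - X) \<le> depth \<kappa> (Y - X)"
proof -
  have "(sqrt (1 - \<delta>0\<^sup>2) * cost \<kappa> X Y)\<^sup>2 = (1 - \<delta>0\<^sup>2) * (cost \<kappa> X Y)\<^sup>2"
    using d by (simp add: power_mult_distrib abs_square_le_1)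
  also have "\<dots> \<le> (depth \<kappa> (Y - X))\<^sup>2"
    unfolding depth_sq using inside by (simp add: algebra_simps)
  finally have 1: "sqrt (1 - \<delta>0\<^sup>2) * cost \<kappa> X Y \<le> depth \<kappa> (Y - X)"
    using nn by (rule power2_le_imp_le)
  have "\<kappa> * snd (Y - X) \<le> \<kappa> * norm (Y - X)"
    using k abs_snd_le_norm[of "Y - X"] by (intro mult_left_mono) auto
  then have "(1 - \<kappa>) * norm (Y - X) \<le> cost \<kappa> X Y"
    unfolding cost_eq by (simp add: algebra_simps)
  then have "sqrt (1 - \<delta>0\<^sup>2) * ((1 - \<kappa>) * norm (Y - X)) \<le> sqrt (1 - \<delta>0\<^sup>2) * cost \<kappa> X Y"
    using d by (intro mult_left_mono) (auto simp: abs_square_le_1)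
  with 1 show ?thesis by (simp add: cone_bound_def mult.commute mult.left_commute)
qed

lemma admissible_open_cylinder:
  fixes Y X :: "'n::finite point"
  assumes k: "0 < \<kappa>" "\<kappa> < 1" and d: "0 < \<delta>0" "\<delta>0 < 1"
    and Y: "Y \<in> admissible_targets \<kappa> M0 \<delta>0 \<Omega>" and X: "X \<in> cylinder \<Omega> M0"
  shows "0 < cost \<kappa> X Y" "0 \<le> snd (Y - X)"
    "cone_bound \<kappa> \<delta>0 * norm (Y - X) \<le> depth \<kappa> (Y - X)"
    "\<And>x. x \<in> \<Omega> \<Longrightarrow> norm (x - fst Y) \<le> \<delta>0 * cost \<kappa> X Y / sqrt (1 - \<kappa>\<^sup>2)"
    "\<And>x. x \<in> \<Omega> \<Longrightarrow> (1 - \<kappa>\<^sup>2) * (norm (x - fst Y))\<^sup>2 \<le> \<delta>0\<^sup>2 * (cost \<kappa> X Y)\<^sup>2"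
proof -
  have w: "1 - \<kappa>\<^sup>2 > 0" using k by (simp add: abs_square_less_1)
  have Y1: "snd X \<le> snd Y - \<kappa> * cost \<kappa> X Y / (1 - \<kappa>\<^sup>2)"
    and Y2: "\<Omega> \<subseteq> ball (fst Y) (\<delta>0 * cost \<kappa> X Y / sqrt (1 - \<kappa>\<^sup>2))"
    using Y X by (auto simp: admissible_targets_def)
  have ball: "norm (x - fst Y) < \<delta>0 * cost \<kappa> X Y / sqrt (1 - \<kappa>\<^sup>2)" if "x \<in> \<Omega>" for x
    using Y2 that by (auto simp: dist_norm norm_minus_commute)
  then show 4: "\<And>x. x \<in> \<Omega> \<Longrightarrow> norm (x - fst Y) \<le> \<delta>0 * cost \<kappa> X Y / sqrt (1 - \<kappa>\<^sup>2)"
    by (rule less_imp_le)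
  have x: "fst X \<in> \<Omega>" using X by (auto simp: cylinder_def)
  have "0 < \<delta>0 * cost \<kappa> X Y / sqrt (1 - \<kappa>\<^sup>2)"
    using ball[OF x] by (smt (verit) norm_ge_zero)
  then show b: "0 < cost \<kappa> X Y"
    using d w by (simp add: zero_less_divide_iff zero_less_mult_iff)
  show 5: "(1 - \<kappa>\<^sup>2) * (norm (x - fst Y))\<^sup>2 \<le> \<delta>0\<^sup>2 * (cost \<kappa> X Y)\<^sup>2" if "x \<in> \<Omega>" for x
  proof -
    have "(norm (x - fst Y))\<^sup>2 \<le> (\<delta>0 * cost \<kappa> X Y / sqrt (1 - \<kappa>\<^sup>2))\<^sup>2"
      using 4[OF that] by (intro power_mono) auto
    then show ?thesis using w by (simp add: power_divide power_mult_distrib field_simps)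
  qed
  have "\<kappa> * cost \<kappa> X Y \<le> (1 - \<kappa>\<^sup>2) * snd (Y - X)"
    using Y1 w by (simp add: field_simps)
  moreover have "0 \<le> \<kappa> * cost \<kappa> X Y" using b k by simp
  ultimately have "0 \<le> depth \<kappa> (Y - X)" "0 \<le> (1 - \<kappa>\<^sup>2) * snd (Y - X)"
    by (simp add: depth_def cost_eq algebra_simps power2_eq_square, linarith)
  then show "cone_bound \<kappa> \<delta>0 * norm (Y - X) \<le> depth \<kappa> (Y - X)" "0 \<le> snd (Y - X)"
    using depth_ge_cone_bound[OF k d less_imp_le[OF b] 5[OF x]] w by (auto simp: zero_le_mult_iff)
qed

text \<open>The graph of a refractor may touch the bottom and top faces of the cylinder, where
  admissibility says nothing directly. All the bounds are closed conditions on the height t, so they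
  pass to the limit from the open interval.\<close>

lemma admissible_closed_cylinder:
  fixes \<Omega> :: "(real^'n::finite) set"
  assumes k: "0 < \<kappa>" "\<kappa> < 1" and d: "0 < \<delta>0" "\<delta>0 < 1" and M: "0 < M0"
    and Om: "open \<Omega>" "\<Omega> \<noteq> {}"
  obtains R where "0 < R"
    "\<And>Y x t. \<lbrakk>Y \<in> admissible_targets \<kappa> M0 \<delta>0 \<Omega>; x \<in> \<Omega>; t \<in> {0..M0}\<rbrakk> \<Longrightarrow>
      Y - (x, t) \<in> steep_cone \<kappa> (cone_bound \<kappa> \<delta>0) R \<and> 0 \<le> cost \<kappa> (x, t) Y \<and>
      (\<forall>x'\<in>\<Omega>. (1 - \<kappa>\<^sup>2) * (norm (x' - fst Y))\<^sup>2 \<le> \<delta>0\<^sup>2 * (cost \<kappa> (x, t) Y)\<^sup>2)"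
proof -
  have w: "1 - \<kappa>\<^sup>2 > 0" using k by (simp add: abs_square_less_1)
  obtain x1 where x1: "x1 \<in> \<Omega>" using Om by auto
  then obtain e where e: "e > 0" "cball x1 e \<subseteq> \<Omega>"
    using Om open_contains_cball by blast
  define x2 where "x2 = x1 + e *\<^sub>R axis i 1"
  have "dist x1 x2 = e" using e by (simp add: x2_def dist_norm)
  then have x2: "x2 \<in> \<Omega>" "norm (x1 - x2) = e" using e by (auto simp: dist_norm)
  \<comment> \<open>The points \<open>x1\<close>, \<open>x2\<close> at distance e both lie within
    \<delta>0 cost / sqrt (1 - \<kappa>^2) of \<open>fst Y\<close>, so e is at most twice that
    radius; this bounds the cost, and then |Y - X|, below by R.\<close>
  define R where "R = e * sqrt (1 - \<kappa>\<^sup>2) / (2 * \<delta>0)"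
  have R: "R > 0" using e w d by (simp add: R_def)
  have "Y - (x, t) \<in> steep_cone \<kappa> (cone_bound \<kappa> \<delta>0) R \<and> 0 \<le> cost \<kappa> (x, t) Y \<and>
      (\<forall>x'\<in>\<Omega>. (1 - \<kappa>\<^sup>2) * (norm (x' - fst Y))\<^sup>2 \<le> \<delta>0\<^sup>2 * (cost \<kappa> (x, t) Y)\<^sup>2)"
    if Y: "Y \<in> admissible_targets \<kappa> M0 \<delta>0 \<Omega>" and x: "x \<in> \<Omega>" and t: "t \<in> {0..M0}" for Y x t
  proof -
    define A where "A = {t. cone_bound \<kappa> \<delta>0 * norm (Y - (x, t)) \<le> snd (Y - (x, t)) - \<kappa> * norm (Y - (x, t))} \<inter>
      {t. R \<le> norm (Y - (x, t))} \<inter> {t. 0 \<le> norm (Y - (x, t)) - \<kappa> * snd (Y - (x, t))} \<inter>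
      (\<Inter>x'\<in>\<Omega>. {t. (1 - \<kappa>\<^sup>2) * (norm (x' - fst Y))\<^sup>2 \<le> \<delta>0\<^sup>2 * (norm (Y - (x, t)) - \<kappa> * snd (Y - (x, t)))\<^sup>2})"
    have "closed A"
      unfolding A_def by (intro closed_Int closed_INT ballI closed_Collect_le continuous_intros)
    moreover have "{0<..<M0} \<subseteq> A"
    proof
      fix t assume "t \<in> {0<..<M0}"
      then have X: "(x, t) \<in> cylinder \<Omega> M0" using x by (simp add: cylinder_def)
      note a = admissible_open_cylinder[OF k d Y X]
      have "e \<le> norm (x1 - fst Y) + norm (x2 - fst Y)"
        using norm_triangle_ineq4[of "x1 - fst Y" "x2 - fst Y"] x2 by simp
      then have "e \<le> 2 * (\<delta>0 * cost \<kappa> (x, t) Y / sqrt (1 - \<kappa>\<^sup>2))"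
        using a(4)[OF x1] a(4)[OF x2(1)] by linarith
      then have "R \<le> cost \<kappa> (x, t) Y"
        unfolding R_def using w d by (simp add: field_simps)
      moreover have "0 \<le> \<kappa> * snd (Y - (x, t))" using a(2) k by simp
      ultimately have "R \<le> norm (Y - (x, t))" unfolding cost_eq by linarith
      then show "t \<in> A"
        using a(1,3,5) unfolding A_def cost_eq depth_def by auto
    qed
    ultimately have "closure {0<..<M0} \<subseteq> A" by (rule closure_minimal[rotated])
    then have "t \<in> A" using t M by auto
    then show ?thesis
      unfolding A_def cost_eq depth_def steep_cone_def by auto
  qed
  with R that show ?thesis by blast
qed

section \<open>Regular targets\<close>

text \<open>Points where two ellipsoids through the origin meet arbitrarily close to it. The map
  \<open>\<zeta> \<mapsto> \<zeta> / qform \<kappa> \<zeta>\<close> turns the ellipsoids into hyperplanes, so it suffices to move far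
  away in their intersection.\<close>

lemma ellipsoids_meet_near_vertex:
  fixes v1 v2 :: "real^'n::finite"
  assumes kappa: "0 < \<kappa>" "\<kappa> < 1" and dim: "CARD('n) \<ge> 2" and ne: "v1 \<noteq> v2"
    and m: "\<bar>m1\<bar> \<le> m" and V: "norm v1 \<le> V" and e: "0 < \<epsilon>"
  obtains \<xi> :: "'n point" where "0 < norm (fst \<xi>)" "norm (fst \<xi>) < \<epsilon>"
    "\<bar>snd \<xi>\<bar> \<le> (m + V) * norm (fst \<xi>)"
    "m1 * qform \<kappa> \<xi> - snd \<xi> + v1 \<bullet> fst \<xi> = 0" "m2 * qform \<kappa> \<xi> - snd \<xi> + v2 \<bullet> fst \<xi> = 0"
proof -
  define w where "w = v2 - v1"
  have w: "w \<bullet> w \<noteq> 0" using ne by (simp add: w_def)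
  \<comment> \<open>A direction along the intersection of the two hyperplanes exists because the
    dimension is at least 2.\<close>
  obtain a where a: "a \<noteq> 0" "orthogonal w a"
    using orthogonal_to_vector_exists[of w] dim by auto
  define i where "i = a /\<^sub>R norm a"
  have i: "i \<bullet> i = 1" "w \<bullet> i = 0" "norm i = 1"
    using a by (auto simp: i_def orthogonal_def power2_norm_eq_inner[symmetric] power2_eq_square)
  define T where "T = 1 / \<epsilon> + 1"
  have T: "T > 1 / \<epsilon>" "T \<ge> 1" using e by (auto simp: T_def)
  \<comment> \<open>After inversion the ellipsoids are the graphs of z -> m_i + v_i . z. They meet
    over the hyperplane w . z = m1 - m2; the first summand is a point of it, and T moves far away
    inside it.\<close>
  define z where "z = ((m1 - m2) / (w \<bullet> w)) *\<^sub>R w + T *\<^sub>R i"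
  define t where "t = m1 + v1 \<bullet> z"
  define N where "N = qform \<kappa> (z, t)"
  have wz: "w \<bullet> z = m1 - m2" using w i by (simp add: z_def inner_add_right)
  have "T = z \<bullet> i" using i by (simp add: z_def inner_add_left)
  then have zT: "T \<le> norm z" using norm_cauchy_schwarz[of z i] i by simp
  then have z1: "norm z \<ge> 1" using T by simp
  have "(norm z)\<^sup>2 \<le> N"
    using kappa unfolding N_def qform_def by (simp add: abs_square_le_1)
  moreover have "(norm z)\<^sup>2 \<ge> 1" using z1 by simp
  ultimately have N: "N > 0" "norm z * norm z \<le> N" by (auto simp: power2_eq_square)
  \<comment> \<open>Inverting back: a point with |z| >= T becomes one whose first component has norm
    at most 1 / T < \<epsilon>.\<close>
  define \<xi> :: "'n point" where "\<xi> = (z /\<^sub>R N, t / N)"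
  have nf: "norm (fst \<xi>) = norm z / N" using N by (simp add: \<xi>_def divide_inverse mult.commute)
  have "qform \<kappa> \<xi> = ((norm z)\<^sup>2 + (1 - \<kappa>\<^sup>2) * t\<^sup>2) / N\<^sup>2"
    unfolding qform_def nf by (simp add: \<xi>_def power_divide add_divide_distrib)
  also have "(norm z)\<^sup>2 + (1 - \<kappa>\<^sup>2) * t\<^sup>2 = N" by (simp add: N_def qform_def)
  finally have q: "qform \<kappa> \<xi> = 1 / N" using N by (simp add: power2_eq_square)
  show thesis
  proof
    show "0 < norm (fst \<xi>)" unfolding nf using N z1 by (intro divide_pos_pos) auto
    have "a / N \<le> 1 / a" if "0 < a" "a * a \<le> N" for a
      using that N by (simp add: field_simps)
    note this[of "norm z"]
    then have "norm z / N \<le> 1 / norm z" using N z1 by linarith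
    also have "\<dots> \<le> 1 / T" by (intro divide_left_mono mult_pos_pos) (use zT T in linarith)+
    also have "\<dots> < \<epsilon>" using T e by (simp add: field_simps)
    finally show "norm (fst \<xi>) < \<epsilon>" unfolding nf .
    have "\<bar>t\<bar> \<le> \<bar>m1\<bar> + \<bar>v1 \<bullet> z\<bar>" unfolding t_def by (rule abs_triangle_ineq)
    also have "\<dots> \<le> m * norm z + V * norm z"
      using m z1 V Cauchy_Schwarz_ineq2[of v1 z] mult_right_mono[OF V, of "norm z"]
        mult_left_mono[OF z1, of m] by (intro add_mono) linarith+
    finally have "\<bar>t\<bar> / N \<le> ((m + V) * norm z) / N"
      using N by (intro divide_right_mono) (auto simp: distrib_right)
    then show "\<bar>snd \<xi>\<bar> \<le> (m + V) * norm (fst \<xi>)" unfolding nf using N by (simp add: \<xi>_def)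
    show "m1 * qform \<kappa> \<xi> - snd \<xi> + v1 \<bullet> fst \<xi> = 0"
      unfolding q using N by (simp add: \<xi>_def t_def field_simps)
    have "v2 \<bullet> z = v1 \<bullet> z + (m1 - m2)" using wz by (simp add: w_def inner_diff_left)
    then show "m2 * qform \<kappa> \<xi> - snd \<xi> + v2 \<bullet> fst \<xi> = 0"
      unfolding q using N by (simp add: \<xi>_def t_def field_simps)
  qed
qed

locale target_setting =
  fixes \<kappa> M0 \<delta>0 R :: real and \<Omega> :: "(real^'n::finite) set" and S :: "'n point set"
    and s :: "'n point \<Rightarrow> 'n point \<Rightarrow> real"
  assumes kappa: "0 < \<kappa>" "\<kappa> < 1" and delta0: "0 < \<delta>0" "\<delta>0 < 1"
    and R: "0 < R" and open_\<Omega>: "open \<Omega>"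
    and curves: "curve_condition \<kappa> (cylinder \<Omega> M0) S s"
    and target: "\<And>Y x t. \<lbrakk>Y \<in> S; x \<in> \<Omega>; t \<in> {0..M0}\<rbrakk> \<Longrightarrow>
      Y - (x, t) \<in> steep_cone \<kappa> (cone_bound \<kappa> \<delta>0) R \<and> 0 \<le> cost \<kappa> (x, t) Y \<and>
      (\<forall>x'\<in>\<Omega>. (1 - \<kappa>\<^sup>2) * (norm (x' - fst Y))\<^sup>2 \<le> \<delta>0\<^sup>2 * (cost \<kappa> (x, t) Y)\<^sup>2)"
begin

abbreviation "\<gamma> \<equiv> cone_bound \<kappa> \<delta>0"
abbreviation "cyl \<equiv> cylinder \<Omega> M0"

lemma gamma_pos: "0 < \<gamma>" using kappa delta0 by (rule cone_bound_pos)

lemma target_cyl: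
  assumes "Y \<in> S" "Z \<in> cyl"
  shows "Y - Z \<in> steep_cone \<kappa> \<gamma> R" "0 < depth \<kappa> (Y - Z)"
proof -
  show "Y - Z \<in> steep_cone \<kappa> \<gamma> R"
    using target[of Y "fst Z" "snd Z"] assms by (cases Z) (auto simp: cylinder_def)
  then show "0 < depth \<kappa> (Y - Z)" using depth_cone[OF _ gamma_pos R] by blast
qed

lemma v_interp_eq:
  assumes "Y1 \<in> S" "Y2 \<in> S" "Z \<in> cyl"
  shows "v_interp \<kappa> Z Y1 Y2 l = (1 - l) *\<^sub>R slope \<kappa> (Y1 - Z) + l *\<^sub>R slope \<kappa> (Y2 - Z)"
  unfolding v_interp_def using target_cyl assms by (simp add: gradient_phi[OF kappa])

text \<open>Every point of the ray from Z in direction Lam(v) has slope v, whatever its distance.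
  Hence the slope is affine along the curve, and the nonlinearity of the curve shows only in
  \<open>curv\<close>.\<close>

lemma Ycurve_target:
  assumes "Y1 \<in> S" "Y2 \<in> S" "Z \<in> cyl" "l \<in> {0..1}"
  shows "Ycurve \<kappa> s Z Y1 Y2 l \<in> S"
    and "slope \<kappa> (Ycurve \<kappa> s Z Y1 Y2 l - Z) = (1 - l) *\<^sub>R slope \<kappa> (Y1 - Z) + l *\<^sub>R slope \<kappa> (Y2 - Z)"
proof -
  have "Ycurve \<kappa> s Z Y1 Y2 l \<in> S \<inter> {Z + r *\<^sub>R Lam \<kappa> (v_interp \<kappa> Z Y1 Y2 l) |r. r > 0}"
    using curves assms unfolding curve_condition_def by blast
  then obtain r where r: "r > 0" "Ycurve \<kappa> s Z Y1 Y2 l = Z + r *\<^sub>R Lam \<kappa> (v_interp \<kappa> Z Y1 Y2 l)"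
    and S: "Ycurve \<kappa> s Z Y1 Y2 l \<in> S" by blast
  show "Ycurve \<kappa> s Z Y1 Y2 l \<in> S" by (rule S)
  show "slope \<kappa> (Ycurve \<kappa> s Z Y1 Y2 l - Z) = (1 - l) *\<^sub>R slope \<kappa> (Y1 - Z) + l *\<^sub>R slope \<kappa> (Y2 - Z)"
    using r slope_Lam[OF kappa r(1)] v_interp_eq[OF assms(1-3)] by simp
qed

text \<open>Equal slopes put both targets on one ray from Z, and the curve condition for the
  degenerate pair (Y1, Y1) allows only one target there.\<close>

lemma slope_inj_target:
  assumes Y: "Y1 \<in> S" "Y2 \<in> S" and Z: "Z \<in> cyl" and eq: "slope \<kappa> (Y1 - Z) = slope \<kappa> (Y2 - Z)"
  shows "Y1 = Y2"
proof -
  define L where "L = Lam \<kappa> (v_interp \<kappa> Z Y1 Y1 0)"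
  have L: "L = Lam \<kappa> (slope \<kappa> (Y1 - Z))" unfolding L_def using v_interp_eq[OF Y(1) Y(1) Z] by simp
  have on_ray: "Y' \<in> S \<inter> {Z + r *\<^sub>R L |r. r > 0}" if "Y' \<in> S" "slope \<kappa> (Y' - Z) = slope \<kappa> (Y1 - Z)" for Y'
  proof -
    note d = target_cyl(2)[OF that(1) Z]
    have "Y' = Z + norm (Y' - Z) *\<^sub>R L"
      using norm_scaleR_Lam_slope[OF kappa d] that(2) L by simp
    moreover have "norm (Y' - Z) > 0" using d by (auto simp: depth_def)
    ultimately show ?thesis using that(1) by blast
  qed
  have "S \<inter> {Z + r *\<^sub>R L |r. r > 0} = {Ycurve \<kappa> s Z Y1 Y1 0}"
    using curves[unfolded curve_condition_def, rule_format, OF Y(1) Y(1) Z, of 0]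
    unfolding L_def by simp
  then show ?thesis using on_ray[of Y1] on_ray[of Y2] Y eq by auto
qed

text \<open>The 2 pays for an error quadratic in the height gain; the other factor bounds
  \<open>qform \<kappa> \<xi>\<close> by a multiple of |fst \<xi>|^2 at the points where two
  ellipsoids meet.\<close>

definition curv_gain :: "real \<Rightarrow> real" where
  "curv_gain c1 = c1 / (2 * (1 + (1 / (2 * (\<gamma> * R)) + 1 / \<gamma>)\<^sup>2))"

text \<open>Regularity is only assumed near \<open>Z\<close>. Testing it at points where the ellipsoids of
  \<open>Y1\<close> and \<open>Y2\<close> meet turns it into an inequality between curvatures, which no longer mentions
  \<open>x\<close> and therefore controls the ellipsoids globally.\<close>

lemma curv_regular:
  assumes dim: "CARD('n) \<ge> 2"
    and Y: "Y1 \<in> S" "Y2 \<in> S" and Z: "Z \<in> cyl" and l: "l \<in> {0..1}"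
    and c: "0 < c1" "0 < c2"
    and reg: "\<And>x. x \<in> \<Omega> \<Longrightarrow> norm (x - fst Z) \<le> c2 \<Longrightarrow>
        phi \<kappa> x (Ycurve \<kappa> s Z Y1 Y2 l) Z
          \<ge> min (phi \<kappa> x Y1 Z) (phi \<kappa> x Y2 Z) + c1 * (norm (Y1 - Y2))\<^sup>2 * (norm (x - fst Z))\<^sup>2"
  shows "(1 - l) * curv \<kappa> (Y1 - Z) + l * curv \<kappa> (Y2 - Z) + curv_gain c1 * (norm (Y1 - Y2))\<^sup>2
    \<le> curv \<kappa> (Ycurve \<kappa> s Z Y1 Y2 l - Z)"
proof (cases "Y1 = Y2")
  case True
  then have "Ycurve \<kappa> s Z Y1 Y2 l = Y1"
    using Ycurve_target[OF Y Z l] slope_inj_target[OF _ Y(1) Z] by (simp add: algebra_simps)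
  then show ?thesis using True by (simp add: algebra_simps)
next
  case False
  define Yl where "Yl = Ycurve \<kappa> s Z Y1 Y2 l"
  define m V D where "m = 1 / (2 * (\<gamma> * R))" and "V = 1 / \<gamma>" and "D = norm (Y1 - Y2)"
  define v1 v2 vl where "v1 = slope \<kappa> (Y1 - Z)" and "v2 = slope \<kappa> (Y2 - Z)" and "vl = slope \<kappa> (Yl - Z)"
  define m1 m2 ml where "m1 = curv \<kappa> (Y1 - Z)" and "m2 = curv \<kappa> (Y2 - Z)" and "ml = curv \<kappa> (Yl - Z)"
  have gR: "\<gamma> * R > 0" using gamma_pos R by simp
  have mV: "m > 0" "V > 0" using gR gamma_pos by (auto simp: m_def V_def)
  have Yl: "Yl \<in> S" unfolding Yl_def by (rule Ycurve_target[OF Y Z l])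
  have vl: "vl = (1 - l) *\<^sub>R v1 + l *\<^sub>R v2"
    unfolding vl_def v1_def v2_def Yl_def by (rule Ycurve_target[OF Y Z l])
  have mb: "0 < m1" "m1 \<le> m" "0 < m2" "0 < ml" "ml \<le> m"
    unfolding m1_def m2_def ml_def m_def
    using curv_cone[OF target_cyl(1)[OF _ Z] gamma_pos R] Y Yl by auto
  have vb: "norm v1 \<le> V" unfolding v1_def V_def using norm_slope_cone[OF target_cyl(1)[OF Y(1) Z] gamma_pos R] .
  have ne: "v1 \<noteq> v2" unfolding v1_def v2_def using slope_inj_target[OF Y Z] False by blast
  have zO: "fst Z \<in> \<Omega>" using Z by (auto simp: cylinder_def)
  then obtain e0 where e0: "e0 > 0" "ball (fst Z) e0 \<subseteq> \<Omega>"
    using open_\<Omega> openE by blast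
  define A where "A = 2 * (m + V) + c1 * D\<^sup>2"
  have A: "A > 0" using mV c by (auto simp: A_def intro!: add_pos_nonneg)
  \<comment> \<open>c2 and e0 keep the test point where regularity applies; 1 and 1 / (2 m A) make
    the error quadratic in H at most H / 2; \<gamma> R / (m + V) keeps the test point below the
    centres of the ellipsoids.\<close>
  define \<epsilon> where "\<epsilon> = min (min c2 e0) (min (min 1 (\<gamma> * R / (m + V))) (1 / (2 * m * A)))"
  have e: "\<epsilon> > 0" "\<epsilon> \<le> c2" "\<epsilon> \<le> e0" "\<epsilon> \<le> 1" "\<epsilon> \<le> \<gamma> * R / (m + V)" "\<epsilon> \<le> 1 / (2 * m * A)"
    unfolding \<epsilon>_def using c e0 mV gR A by auto
  have e5: "(m + V) * \<epsilon> \<le> \<gamma> * R" and e6: "m * (A * \<epsilon>) \<le> 1 / 2"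
    using e(5,6) mV A by (auto simp: field_simps)
  obtain \<xi> :: "'n point" where xi: "0 < norm (fst \<xi>)" "norm (fst \<xi>) < \<epsilon>"
    "\<bar>snd \<xi>\<bar> \<le> (m + V) * norm (fst \<xi>)"
    and tie: "m1 * qform \<kappa> \<xi> - snd \<xi> + v1 \<bullet> fst \<xi> = 0" "m2 * qform \<kappa> \<xi> - snd \<xi> + v2 \<bullet> fst \<xi> = 0"
    using ellipsoids_meet_near_vertex[OF kappa dim ne _ vb e(1), of m1 m m2] mb by auto
  define n where "n = norm (fst \<xi>)"
  have n: "0 < n" "n < \<epsilon>" "n \<le> 1" using xi e by (auto simp: n_def)
  define q where "q = qform \<kappa> \<xi>"
  define H where "H = c1 * D\<^sup>2 * n\<^sup>2"
  have H: "H > 0" using c False n by (simp add: H_def D_def)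
  have w: "0 < 1 - \<kappa>\<^sup>2" "1 - \<kappa>\<^sup>2 \<le> 1" using kappa by (auto simp: abs_square_less_1)
  have s1: "\<bar>snd \<xi>\<bar> \<le> (m + V) * \<epsilon>"
    using xi(3) n mV unfolding n_def[symmetric] by (smt (verit) mult_left_mono)
  have sd: "(1 - \<kappa>\<^sup>2) * snd \<xi> \<le> \<gamma> * R"
  proof -
    have "(1 - \<kappa>\<^sup>2) * snd \<xi> \<le> (1 - \<kappa>\<^sup>2) * \<bar>snd \<xi>\<bar>" using w by (intro mult_left_mono) auto
    also have "\<dots> \<le> 1 * \<bar>snd \<xi>\<bar>" using w by (intro mult_right_mono) auto
    finally show ?thesis using s1 e5 by linarith
  qed
  define X where "X = Z + \<xi>"
  have below: "snd X \<le> phi \<kappa> (fst X) Y' Z"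
    if "Y' \<in> S" "defect \<kappa> (Y' - Z) \<xi> = 0" for Y'
    by (rule le_phi_defect(2)[OF kappa target_cyl(2)[OF that(1) Z]])
      (use that sd depth_cone(1)[OF target_cyl(1)[OF that(1) Z] gamma_pos R] in \<open>auto simp: X_def\<close>)
  have "snd X \<le> phi \<kappa> (fst X) Y1 Z" "snd X \<le> phi \<kappa> (fst X) Y2 Z"
    using tie below[OF Y(1)] below[OF Y(2)]
    by (auto simp: defect_def m1_def m2_def v1_def v2_def)
  moreover have "fst X \<in> \<Omega>"
    using e0(2) n e(3) by (auto simp: X_def dist_norm n_def subset_iff)
  \<comment> \<open>X lies below both ellipsoids, so regularity leaves room to raise it by H below
    the ellipsoid of \<open>Yl\<close>.\<close>
  ultimately have "snd X + H \<le> phi \<kappa> (fst X) Yl Z"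
    using reg[of "fst X"] n e(2) unfolding Yl_def H_def D_def n_def by (auto simp: X_def)
  then have "0 \<le> defect \<kappa> (Yl - Z) (X + (0, H) - Z)"
    using le_phi_defect(1)[OF kappa target_cyl(2)[OF Yl Z], of "X + (0, H)"] by simp
  then have "0 \<le> ml * (q + (1 - \<kappa>\<^sup>2) * (H * (2 * snd \<xi> + H))) - snd \<xi> - H + vl \<bullet> fst \<xi>"
    unfolding defect_def ml_def vl_def q_def
    by (simp add: X_def qform_def algebra_simps power2_eq_square)
  \<comment> \<open>The slope is affine along the curve, so averaging the two vanishing defects
    removes every term except the difference of curvatures.\<close>
  moreover have "((1 - l) * m1 + l * m2) * q - snd \<xi> + vl \<bullet> fst \<xi>
      = (1 - l) * (m1 * q - snd \<xi> + v1 \<bullet> fst \<xi>) + l * (m2 * q - snd \<xi> + v2 \<bullet> fst \<xi>)"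
    unfolding vl by (simp add: algebra_simps inner_add_left)
  then have "((1 - l) * m1 + l * m2) * q - snd \<xi> + vl \<bullet> fst \<xi> = 0"
    using tie unfolding q_def by simp
  moreover have "ml * ((1 - \<kappa>\<^sup>2) * (H * (2 * snd \<xi> + H))) \<le> H / 2"
  proof -
    have "n\<^sup>2 \<le> \<epsilon>" using n unfolding power2_eq_square by (smt (verit) mult_left_le)
    then have "H \<le> c1 * D\<^sup>2 * \<epsilon>" unfolding H_def using c by (intro mult_left_mono) auto
    then have "2 * snd \<xi> + H \<le> A * \<epsilon>"
      using s1 unfolding A_def by (simp add: algebra_simps)
    then have "H * (2 * snd \<xi> + H) \<le> H * (A * \<epsilon>)" using H by (intro mult_left_mono) auto
    then have "(1 - \<kappa>\<^sup>2) * (H * (2 * snd \<xi> + H)) \<le> (1 - \<kappa>\<^sup>2) * (H * (A * \<epsilon>))"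
      by (rule mult_left_mono) (use w in auto)
    also have "\<dots> \<le> 1 * (H * (A * \<epsilon>))" using w H A e by (intro mult_right_mono) auto
    finally have "(1 - \<kappa>\<^sup>2) * (H * (2 * snd \<xi> + H)) \<le> H * (A * \<epsilon>)" by simp
    then have "ml * ((1 - \<kappa>\<^sup>2) * (H * (2 * snd \<xi> + H))) \<le> ml * (H * (A * \<epsilon>))"
      by (rule mult_left_mono) (use mb in auto)
    also have "\<dots> \<le> m * (H * (A * \<epsilon>))" using mb H A e by (intro mult_right_mono) auto
    also have "\<dots> = H * (m * (A * \<epsilon>))" by simp
    also have "\<dots> \<le> H * (1 / 2)" using e6 H by (intro mult_left_mono) auto
    finally show ?thesis by simp
  qed
  \<comment> \<open>H is c1 D^2 n^2 and q is at most a multiple of n^2, so n cancels and the test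
    point disappears from the inequality.\<close>
  ultimately have gap: "H / 2 \<le> (ml - ((1 - l) * m1 + l * m2)) * q"
    by (simp add: algebra_simps)
  have "(snd \<xi>)\<^sup>2 \<le> ((m + V) * n)\<^sup>2"
    using xi(3) unfolding n_def by (metis abs_ge_zero power2_abs power_mono)
  then have "(1 - \<kappa>\<^sup>2) * (snd \<xi>)\<^sup>2 \<le> 1 * ((m + V) * n)\<^sup>2"
    using w by (intro mult_mono) auto
  then have "q \<le> n\<^sup>2 + ((m + V) * n)\<^sup>2" unfolding q_def qform_def n_def by simp
  then have q_le: "q \<le> (1 + (m + V)\<^sup>2) * n\<^sup>2"
    by (simp only: power_mult_distrib distrib_right[of 1] mult_1)
  have q0: "q \<ge> 0" unfolding q_def using kappa by (intro qform_nonneg) auto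
  have "0 \<le> ml - ((1 - l) * m1 + l * m2)"
    using gap H q0 by (smt (verit) mult_nonneg_nonpos2 mult_nonpos_nonneg divide_pos_pos)
  then have "H / 2 \<le> (ml - ((1 - l) * m1 + l * m2)) * ((1 + (m + V)\<^sup>2) * n\<^sup>2)"
    using gap q_le by (smt (verit) mult_left_mono)
  then have "c1 * D\<^sup>2 / 2 * n\<^sup>2 \<le> (ml - ((1 - l) * m1 + l * m2)) * (1 + (m + V)\<^sup>2) * n\<^sup>2"
    unfolding H_def by (simp add: mult.assoc)
  then have "c1 * D\<^sup>2 / 2 \<le> (ml - ((1 - l) * m1 + l * m2)) * (1 + (m + V)\<^sup>2)"
    by (rule mult_right_le_imp_le) (use n in simp)
  moreover have "1 + (m + V)\<^sup>2 > 0" by (simp add: add_pos_nonneg)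
  ultimately have "c1 / (2 * (1 + (m + V)\<^sup>2)) * D\<^sup>2 \<le> ml - ((1 - l) * m1 + l * m2)"
    by (simp add: field_simps)
  then show ?thesis
    unfolding curv_gain_def m_def[symmetric] V_def[symmetric] D_def[symmetric]
      m1_def[symmetric] m2_def[symmetric] Yl_def[symmetric] ml_def[symmetric] by simp
qed

end

section \<open>Supporting ellipsoids of a refractor\<close>

lemma mult_le_abs_bound:
  fixes a b c :: real
  assumes "0 < c" "c < 1" "\<bar>a\<bar> \<le> b"
  shows "c * a \<le> b"
proof -
  have "c * a \<le> c * \<bar>a\<bar>" using assms by (intro mult_left_mono) auto
  also have "\<dots> \<le> 1 * \<bar>a\<bar>" using assms by (intro mult_right_mono) auto
  finally show ?thesis using assms by simp
qed

lemma cost_pos_cone: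
  assumes "0 < \<kappa>" "\<kappa> < 1" "Y - X \<in> steep_cone \<kappa> \<gamma> R" "0 < R"
  shows "0 < cost \<kappa> X Y"
proof -
  have "R \<le> norm (Y - X)" using assms by (simp add: steep_cone_def)
  then have "0 < norm (Y - X)" using assms(4) by linarith
  from mult_strict_right_mono[OF assms(2) this]
  have "\<kappa> * norm (Y - X) < norm (Y - X)" by simp
  moreover have "\<kappa> * snd (Y - X) \<le> \<kappa> * norm (Y - X)"
    by (intro mult_left_mono) (use abs_snd_le_norm[of "Y - X"] assms(1) in linarith)+
  ultimately show ?thesis unfolding cost_eq by simp
qed

lemma cost_lipschitz:
  fixes X X' Y :: "'n::finite point"
  assumes "0 < \<kappa>" "\<kappa> < 1"
  shows "cost \<kappa> X Y \<le> cost \<kappa> X' Y + 2 * norm (X - X')"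
proof -
  have "norm (Y - X) \<le> norm (Y - X') + norm (X - X')"
    using norm_triangle_ineq4[of "Y - X'" "X - X'"] by simp
  moreover have "\<kappa> * (snd X - snd X') \<le> norm (X - X')"
    using abs_snd_le_norm[of "X - X'"] assms by (intro mult_le_abs_bound) auto
  ultimately show ?thesis unfolding cost_eq by (simp add: algebra_simps)
qed

lemma continuous_on_phi:
  assumes "continuous_on A z"
  shows "continuous_on A (\<lambda>l. phi \<kappa> (z l) Y X0)"
proof -
  define c1 c2 c3 where "c1 = snd Y - \<kappa> * cost \<kappa> X0 Y / (1 - \<kappa>\<^sup>2)"
    and "c2 = (cost \<kappa> X0 Y)\<^sup>2 / (1 - \<kappa>\<^sup>2)\<^sup>2" and "c3 = inverse (1 - \<kappa>\<^sup>2)"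
  have "phi \<kappa> x Y X0 = c1 - sqrt (c2 - (norm (x - fst Y))\<^sup>2 * c3)" for x
    by (simp add: phi_def c1_def c2_def c3_def divide_inverse)
  then show ?thesis using assms by (auto intro!: continuous_intros)
qed

locale refractor_setting = target_setting \<kappa> M0 \<delta>0 R \<Omega> S s
  for \<kappa> M0 \<delta>0 R :: real and \<Omega> :: "(real^'n::finite) set" and S :: "'n point set"
    and s :: "'n point \<Rightarrow> 'n point \<Rightarrow> real" +
  fixes u :: "real^'n \<Rightarrow> real"
  assumes refractor: "parallel_refractor \<kappa> M0 \<Omega> S u"
begin

abbreviation "F \<equiv> refractor_map \<kappa> \<Omega> S u"

abbreviation graph :: "real^'n \<Rightarrow> 'n point" where "graph x \<equiv> (x, u x)"

lemma u_range: "x \<in> \<Omega> \<Longrightarrow> u x \<in> {0..M0}"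
  using refractor by (simp add: parallel_refractor_def)

lemma F_nonempty: "x \<in> \<Omega> \<Longrightarrow> \<exists>Y. Y \<in> F x"
  using refractor by (auto simp: parallel_refractor_def)

lemma F_target: "Y \<in> F x \<Longrightarrow> Y \<in> S"
  by (simp add: refractor_map_def)

lemma graph_cone: "Y \<in> S \<Longrightarrow> x \<in> \<Omega> \<Longrightarrow> Y - graph x \<in> steep_cone \<kappa> \<gamma> R"
  using target u_range by blast

lemma graph_depth: "Y \<in> S \<Longrightarrow> x \<in> \<Omega> \<Longrightarrow> 0 < depth \<kappa> (Y - graph x)"
  using depth_cone(2)[OF graph_cone gamma_pos R] .

section \<open>First-order bounds for the refractor\<close>

lemma refractor_cost:
  assumes "Y \<in> F x0" "x \<in> \<Omega>"
  shows "cost \<kappa> (graph x0) Y \<le> cost \<kappa> (graph x) Y"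
  using cost_ge_of_le_phi[OF kappa, of "graph x" Y "graph x0"] assms by (auto simp: refractor_map_def)

lemma refractor_defect:
  assumes "Y \<in> F x0" "x0 \<in> \<Omega>" "x \<in> \<Omega>"
  shows "0 \<le> defect \<kappa> (Y - graph x0) (graph x - graph x0)"
  using le_phi_defect(1)[OF kappa graph_depth[OF F_target[OF assms(1)] assms(2)], of "graph x"] assms
  by (auto simp: refractor_map_def)

text \<open>\<open>graph x\<close> stays outside the supporting ellipsoid at y. Seen from
  \<open>graph x\<close>, the focus lies in the cone, so the cost falls upwards at rate at least
  \<gamma>, and \<open>graph x\<close> cannot be much higher than \<open>graph y\<close>.\<close>

lemma u_lipschitz:
  assumes "x \<in> \<Omega>" "y \<in> \<Omega>"
  shows "\<bar>u x - u y\<bar> \<le> norm (x - y) / \<gamma>"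
proof -
  have "u x - u y \<le> norm (x - y) / \<gamma>" if xy: "x \<in> \<Omega>" "y \<in> \<Omega>" for x y
  proof -
    obtain Y where Y: "Y \<in> F y" using F_nonempty[OF xy(2)] by blast
    have c: "Y - graph x \<in> steep_cone \<kappa> \<gamma> R" using graph_cone F_target[OF Y] xy by blast
    then have "Y \<noteq> graph x" using R by (auto simp: steep_cone_def)
    then show ?thesis
      using cost_steep[OF kappa(2) _ gamma_pos, of Y "graph x" "graph y"] c refractor_cost[OF Y xy(1)]
      by (auto simp: steep_cone_def)
  qed
  from this[OF assms] this[OF assms(2,1)] show ?thesis by (simp add: norm_minus_commute abs_le_iff)
qed

definition tangent_const :: real where
  "tangent_const = 1 / (2 * (\<gamma> * R)) * (1 + 1 / \<gamma>\<^sup>2)"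

lemma tangent_const_pos: "0 < tangent_const"
  unfolding tangent_const_def using gamma_pos R by (intro mult_pos_pos divide_pos_pos add_pos_nonneg) auto

text \<open>A semiconcavity estimate: outside the supporting ellipsoid the defect is nonnegative,
  and its curvature term is quadratic by the Lipschitz bound. Each target in \<open>F x0\<close>
  thus supplies a candidate gradient.\<close>

lemma u_le_tangent:
  assumes Y: "Y \<in> F x0" and x: "x0 \<in> \<Omega>" "x \<in> \<Omega>"
  shows "u x \<le> u x0 + slope \<kappa> (Y - graph x0) \<bullet> (x - x0) + tangent_const * (norm (x - x0))\<^sup>2"
proof -
  define \<xi> where "\<xi> = graph x - graph x0"
  note cv = curv_cone[OF graph_cone[OF F_target[OF Y] x(1)] gamma_pos R]
  have "\<bar>u x - u x0\<bar>\<^sup>2 \<le> (norm (x - x0) / \<gamma>)\<^sup>2"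
    by (rule power_mono[OF u_lipschitz[OF x(2,1)]]) simp
  then have "(norm \<xi>)\<^sup>2 \<le> (1 + 1 / \<gamma>\<^sup>2) * (norm (x - x0))\<^sup>2"
    unfolding norm_point_sq by (simp add: \<xi>_def power_divide algebra_simps)
  then have "qform \<kappa> \<xi> \<le> (1 + 1 / \<gamma>\<^sup>2) * (norm (x - x0))\<^sup>2"
    using qform_le[of \<kappa> \<xi>] kappa by linarith
  then have "curv \<kappa> (Y - graph x0) * qform \<kappa> \<xi> \<le> 1 / (2 * (\<gamma> * R)) * ((1 + 1 / \<gamma>\<^sup>2) * (norm (x - x0))\<^sup>2)"
    using cv qform_nonneg[of \<kappa> \<xi>] kappa mult_pos_pos[OF gamma_pos R] by (intro mult_mono) auto
  then show ?thesis
    using refractor_defect[OF Y x] unfolding defect_def \<xi>_def[symmetric] tangent_const_def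
    by (simp add: \<xi>_def)
qed

text \<open>Intermediate value theorem on the segment: at x1 the first ellipsoid touches the graph
  of u and the second lies above or on it, and at x2 the roles are exchanged. The bound on t keeps
  the crossing point near the graph.\<close>

lemma supporting_ellipsoids_cross:
  assumes x: "x1 \<in> \<Omega>" "x2 \<in> \<Omega>" and seg: "closed_segment x1 x2 \<subseteq> \<Omega>"
    and Y: "Y1 \<in> F x1" "Y2 \<in> F x2"
  obtains l t where "l \<in> {0..1}" "u ((1 - l) *\<^sub>R x1 + l *\<^sub>R x2) \<le> t"
    "t \<le> u x1 + norm (x2 - x1) / \<gamma>"
    "cost \<kappa> ((1 - l) *\<^sub>R x1 + l *\<^sub>R x2, t) Y1 = cost \<kappa> (graph x1) Y1"
    "cost \<kappa> ((1 - l) *\<^sub>R x1 + l *\<^sub>R x2, t) Y2 = cost \<kappa> (graph x2) Y2"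
proof -
  define z where "z l = (1 - l) *\<^sub>R x1 + l *\<^sub>R x2" for l :: real
  define h where "h l = phi \<kappa> (z l) Y1 (graph x1) - phi \<kappa> (z l) Y2 (graph x2)" for l
  have base: "phi \<kappa> x Y (graph x) = u x" if "Y \<in> F x" "x \<in> \<Omega>" for x Y
    using phi_base[OF kappa, of Y "graph x"] graph_depth[OF F_target[OF that(1)] that(2)] by simp
  have "h 0 \<le> 0" using base[OF Y(1) x(1)] Y(2) x by (simp add: h_def z_def refractor_map_def)
  moreover have "0 \<le> h 1" using base[OF Y(2) x(2)] Y(1) x by (simp add: h_def z_def refractor_map_def)
  moreover have "continuous_on {0..1} h"
    unfolding h_def z_def by (intro continuous_on_diff continuous_on_phi continuous_intros)
  ultimately obtain l where l: "0 \<le> l" "l \<le> 1" "h l = 0"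
    using IVT'[of h 0 0 1] by auto
  define t where "t = phi \<kappa> (z l) Y1 (graph x1)"
  define Z where "Z = (z l, t)"
  have zO: "z l \<in> \<Omega>" using seg l by (auto simp: closed_segment_def z_def)
  have t2: "t = phi \<kappa> (z l) Y2 (graph x2)" using l(3) by (simp add: t_def h_def)
  have inside: "0 \<le> cost \<kappa> (graph x) Y"
    "(1 - \<kappa>\<^sup>2) * (norm (z l - fst Y))\<^sup>2 \<le> \<delta>0\<^sup>2 * (cost \<kappa> (graph x) Y)\<^sup>2"
    "(1 - \<kappa>\<^sup>2) * (norm (z l - fst Y))\<^sup>2 \<le> (cost \<kappa> (graph x) Y)\<^sup>2"
    if "Y \<in> F x" "x \<in> \<Omega>" for x Y
  proof -
    show "0 \<le> cost \<kappa> (graph x) Y" 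
      and 1: "(1 - \<kappa>\<^sup>2) * (norm (z l - fst Y))\<^sup>2 \<le> \<delta>0\<^sup>2 * (cost \<kappa> (graph x) Y)\<^sup>2"
      using target[OF F_target[OF that(1)] that(2) u_range[OF that(2)]] zO by auto
    have "\<delta>0\<^sup>2 * (cost \<kappa> (graph x) Y)\<^sup>2 \<le> 1 * (cost \<kappa> (graph x) Y)\<^sup>2"
      using delta0 by (intro mult_right_mono) (auto simp: abs_square_le_1)
    with 1 show "(1 - \<kappa>\<^sup>2) * (norm (z l - fst Y))\<^sup>2 \<le> (cost \<kappa> (graph x) Y)\<^sup>2" by simp
  qed
  have c1: "cost \<kappa> Z Y1 = cost \<kappa> (graph x1) Y1" "0 \<le> depth \<kappa> (Y1 - Z)"
    using phi_graph[OF kappa, of "graph x1" Y1 Z] inside[OF Y(1) x(1)] by (auto simp: Z_def t_def)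
  have c2: "cost \<kappa> Z Y2 = cost \<kappa> (graph x2) Y2"
    using phi_graph(1)[OF kappa, of "graph x2" Y2 Z] inside[OF Y(2) x(2)] by (auto simp: Z_def t2)
  \<comment> \<open>Z is not known to lie in the cylinder, so \<open>target\<close> does not apply
    to it; the cone bound is transferred through the common value of the cost.\<close>
  have "\<gamma> * norm (Y1 - Z) \<le> depth \<kappa> (Y1 - Z)"
    using depth_ge_cone_bound[OF kappa delta0, of Z Y1] c1 inside[OF Y(1) x(1)] by (simp add: Z_def)
  moreover have "Y1 \<noteq> Z"
    using c1(1) cost_pos_cone[OF kappa graph_cone[OF F_target[OF Y(1)] x(1)] R] by (auto simp: cost_def)
  ultimately have "snd Z - snd (graph x1) \<le> norm (fst Z - fst (graph x1)) / \<gamma>"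
    using c1(1) by (intro cost_steep[OF kappa(2) _ gamma_pos]) auto
  moreover have "norm (z l - x1) \<le> norm (x2 - x1)"
  proof -
    have "z l - x1 = l *\<^sub>R (x2 - x1)" by (simp add: z_def algebra_simps)
    then show ?thesis using l by (simp add: mult_left_le_one_le)
  qed
  ultimately have "t - u x1 \<le> norm (x2 - x1) / \<gamma>"
    using gamma_pos by (simp add: Z_def) (smt (verit) divide_right_mono)
  moreover have "u (z l) \<le> t" using Y(1) zO by (simp add: refractor_map_def t_def)
  ultimately show thesis
    using that[of l t] l c1(1) c2 by (simp add: Z_def z_def)
qed

text \<open>Each ellipsoid passes through Z and through \<open>graph x1\<close> or
  \<open>graph x2\<close>, and lies above its tangent plane at Z; this bounds u from below at x1 and
  x2. From above, u is bounded there by a tangent at \<open>graph z\<close> with a single slope.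
  Averaging eliminates that slope and leaves the difference of the two ellipsoid slopes.\<close>

lemma crossing_gap:
  assumes x: "x1 \<in> \<Omega>" "x2 \<in> \<Omega>" and Y: "Y1 \<in> S" "Y2 \<in> S" and l: "l \<in> {0..1}"
    and z: "z = (1 - l) *\<^sub>R x1 + l *\<^sub>R x2" and Z: "(z, t) \<in> cyl"
    and c: "cost \<kappa> (z, t) Y1 = cost \<kappa> (graph x1) Y1" "cost \<kappa> (z, t) Y2 = cost \<kappa> (graph x2) Y2"
  shows "t - u z \<le> norm (slope \<kappa> (Y1 - (z, t)) - slope \<kappa> (Y2 - (z, t))) * norm (x2 - x1)
      + tangent_const * (norm (x2 - x1))\<^sup>2"
proof -
  define Z where "Z = (z, t)"
  have Zc: "Z \<in> cyl" using Z by (simp add: Z_def)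
  then have zO: "z \<in> \<Omega>" by (simp add: cylinder_def Z_def)
  have above: "t + slope \<kappa> (Y - Z) \<bullet> (x - z) \<le> u x"
    if "Y \<in> S" "cost \<kappa> Z Y = cost \<kappa> (graph x) Y" for x Y
  proof -
    note d = target_cyl(2)[OF that(1) Zc]
    have "defect \<kappa> (Y - Z) (graph x - Z) = 0"
      using defect_cost[of \<kappa> Y Z "graph x"] d that(2) by simp
    moreover have "0 \<le> curv \<kappa> (Y - Z) * qform \<kappa> (graph x - Z)"
      using d kappa by (intro mult_nonneg_nonneg qform_nonneg) (auto simp: curv_def)
    ultimately show ?thesis by (simp add: defect_def Z_def)
  qed
  obtain Y0 where Y0: "Y0 \<in> F z" using F_nonempty[OF zO] by blast
  define v0 v1 v2 where "v0 = slope \<kappa> (Y0 - graph z)" and "v1 = slope \<kappa> (Y1 - Z)"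
    and "v2 = slope \<kappa> (Y2 - Z)"
  define \<Delta> where "\<Delta> = x2 - x1"
  have d1: "x1 - z = - (l *\<^sub>R \<Delta>)" and d2: "x2 - z = (1 - l) *\<^sub>R \<Delta>"
    by (simp_all add: z \<Delta>_def algebra_simps)
  have l01: "0 \<le> l" "l \<le> 1" using l by auto
  have n1: "tangent_const * (norm (x1 - z))\<^sup>2 \<le> tangent_const * (norm \<Delta>)\<^sup>2" "tangent_const * (norm (x2 - z))\<^sup>2 \<le> tangent_const * (norm \<Delta>)\<^sup>2"
    using tangent_const_pos l01 by (auto simp: d1 d2 power_mult_distrib intro!: mult_left_le_one_le power_le_one)
  have "t + v1 \<bullet> (x1 - z) \<le> u x1" "t + v2 \<bullet> (x2 - z) \<le> u x2"
    unfolding v1_def v2_def using above Y c by (auto simp: Z_def)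
  moreover have "u x1 \<le> u z + v0 \<bullet> (x1 - z) + tangent_const * (norm \<Delta>)\<^sup>2" "u x2 \<le> u z + v0 \<bullet> (x2 - z) + tangent_const * (norm \<Delta>)\<^sup>2"
    unfolding v0_def using u_le_tangent[OF Y0 zO x(1)] u_le_tangent[OF Y0 zO x(2)] n1 by linarith+
  ultimately have "t - l * (v1 \<bullet> \<Delta>) \<le> u z - l * (v0 \<bullet> \<Delta>) + tangent_const * (norm \<Delta>)\<^sup>2"
    "t + (1 - l) * (v2 \<bullet> \<Delta>) \<le> u z + (1 - l) * (v0 \<bullet> \<Delta>) + tangent_const * (norm \<Delta>)\<^sup>2"
    unfolding d1 d2 by auto
  \<comment> \<open>The weights 1 - l and l are those with which z is the barycentre of x1 and x2,
    so \<open>v0\<close> cancels.\<close>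
  from mult_left_mono[OF this(1), of "1 - l"] mult_left_mono[OF this(2), of l] l01
  have "(1 - l) * t + l * t \<le> (1 - l) * l * ((v1 - v2) \<bullet> \<Delta>) + ((1 - l) * (u z + tangent_const * (norm \<Delta>)\<^sup>2) + l * (u z + tangent_const * (norm \<Delta>)\<^sup>2))"
    by (simp add: algebra_simps inner_diff_left)
  then have "t - u z \<le> ((1 - l) * l) * ((v1 - v2) \<bullet> \<Delta>) + tangent_const * (norm \<Delta>)\<^sup>2"
    by (simp add: algebra_simps)
  also have "((1 - l) * l) * ((v1 - v2) \<bullet> \<Delta>) \<le> ((1 - l) * l) * (norm (v1 - v2) * norm \<Delta>)"
    using l01 by (intro mult_left_mono norm_cauchy_schwarz) auto
  also have "\<dots> \<le> 1 * (norm (v1 - v2) * norm \<Delta>)"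
    using l01 by (intro mult_right_mono) (auto intro!: mult_le_one)
  finally show ?thesis by (simp add: v1_def v2_def \<Delta>_def Z_def)
qed

section \<open>Graph points that see a target near the curve\<close>

definition slope_const :: real where "slope_const = 1 / (\<gamma> * R) + 2 / (\<gamma>\<^sup>2 * R)"

lemma slope_const_pos: "0 < slope_const"
  unfolding slope_const_def using gamma_pos R by (intro add_pos_pos divide_pos_pos mult_pos_pos) auto

text \<open>The slope part is linear in \<xi>, and one factor |\<xi>| of the quadratic curvature
  part is absorbed in D. This is the origin of the term of order rho h in the balance.\<close>

lemma defect_perturb:
  assumes P: "P \<in> steep_cone \<kappa> \<gamma> R" "P' \<in> steep_cone \<kappa> \<gamma> R" and h: "norm \<xi> \<le> D"
  shows "defect \<kappa> P' \<xi> - defect \<kappa> P \<xi> \<le> (D / (\<gamma> * R)\<^sup>2 + slope_const) * norm (P - P') * norm \<xi>"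
proof -
  have "defect \<kappa> P' \<xi> - defect \<kappa> P \<xi> = (curv \<kappa> P' - curv \<kappa> P) * qform \<kappa> \<xi> + (slope \<kappa> P' - slope \<kappa> P) \<bullet> fst \<xi>"
    by (simp add: defect_def algebra_simps inner_diff_left)
  also have "(curv \<kappa> P' - curv \<kappa> P) * qform \<kappa> \<xi> \<le> (norm (P - P') / (\<gamma> * R)\<^sup>2) * (D * norm \<xi>)"
  proof -
    have "qform \<kappa> \<xi> \<le> D * norm \<xi>"
      using qform_le[of \<kappa> \<xi>] kappa mult_right_mono[OF h, of "norm \<xi>"] by (simp add: power2_eq_square)
    moreover have "\<bar>curv \<kappa> P' - curv \<kappa> P\<bar> \<le> norm (P - P') / (\<gamma> * R)\<^sup>2"
      using curv_lipschitz[OF P gamma_pos R kappa] by (simp add: abs_minus_commute)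
    ultimately show ?thesis
      using qform_nonneg[of \<kappa> \<xi>] kappa by (intro mult_mono) auto
  qed
  also have "(slope \<kappa> P' - slope \<kappa> P) \<bullet> fst \<xi> \<le> (slope_const * norm (P - P')) * norm \<xi>"
  proof -
    have "(slope \<kappa> P' - slope \<kappa> P) \<bullet> fst \<xi> \<le> norm (slope \<kappa> P' - slope \<kappa> P) * norm (fst \<xi>)"
      by (rule norm_cauchy_schwarz)
    also have "\<dots> \<le> (slope_const * norm (P - P')) * norm \<xi>"
      using slope_lipschitz[OF P gamma_pos R kappa] slope_const_pos unfolding slope_const_def[symmetric]
      by (intro mult_mono norm_fst_le_norm) (auto simp: norm_minus_commute)
    finally show ?thesis .
  qed
  finally show ?thesis by (simp add: algebra_simps)
qed

text \<open>The graph lies outside the ellipsoids of Y1 and Y2 through Z, so the averaged defect at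
  \<open>graph x\<close> is nonnegative. The curvature gain makes the defect for the curve point at
  least quadratic there. Passing to the nearby Y costs a term linear in \<rho>, and the defect for Y
  itself is small because its supporting ellipsoid passes through \<open>graph x\<close>.\<close>

lemma contact_near_crossing:
  assumes Y: "Y1 \<in> S" "Y2 \<in> S" and Z: "Z \<in> cyl" and l: "l \<in> {0..1}"
    and gain: "(1 - l) * curv \<kappa> (Y1 - Z) + l * curv \<kappa> (Y2 - Z) + c * (norm (Y1 - Y2))\<^sup>2
      \<le> curv \<kappa> (Ycurve \<kappa> s Z Y1 Y2 l - Z)" and c0: "0 \<le> c"
    and below: "cost \<kappa> Z Y1 \<le> cost \<kappa> (graph x) Y1" "cost \<kappa> Z Y2 \<le> cost \<kappa> (graph x) Y2"
    and x: "x \<in> \<Omega>" and Yx: "Y \<in> F x" and near: "norm (Y - Ycurve \<kappa> s Z Y1 Y2 l) \<le> \<rho>"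
    and D: "norm (graph x - Z) \<le> D" and gap: "0 \<le> snd Z - u (fst Z)"
  shows "c * (1 - \<kappa>\<^sup>2) * (norm (Y1 - Y2))\<^sup>2 * (norm (graph x - Z))\<^sup>2
    \<le> (D / (\<gamma> * R)\<^sup>2 + slope_const) * \<rho> * norm (graph x - Z)
      + (4 / \<gamma> + 2 * D / (\<gamma> * R)) * (snd Z - u (fst Z))"
proof -
  define X \<xi> Yl where "X = graph x" and "\<xi> = X - Z" and "Yl = Ycurve \<kappa> s Z Y1 Y2 l"
  define G where "G = snd Z - u (fst Z)"
  have YS: "Y \<in> S" using F_target[OF Yx] .
  have YlS: "Yl \<in> S" unfolding Yl_def by (rule Ycurve_target[OF Y Z l])
  have zO: "fst Z \<in> \<Omega>" using Z by (auto simp: cylinder_def)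
  have up: "0 \<le> snd (Y' - X)" if "Y' \<in> S" for Y'
  proof -
    have "0 \<le> \<kappa> * norm (Y' - X)" using kappa by simp
    then show ?thesis using graph_depth[OF that x] unfolding X_def depth_def by linarith
  qed
  have factor: "0 \<le> norm (X - Y') + cost \<kappa> Z Y' + \<kappa> * (snd Y' - snd X)" if "Y' \<in> S" for Y'
    using up[OF that] kappa cost_pos_cone[OF kappa target_cyl(1)[OF that Z] R]
    by (intro add_nonneg_nonneg mult_nonneg_nonneg) auto
  have df: "0 \<le> defect \<kappa> (Y' - Z) \<xi>" if "Y' \<in> S" "cost \<kappa> Z Y' \<le> cost \<kappa> X Y'" for Y'
  proof -
    note d = target_cyl(2)[OF that(1) Z]
    have "0 \<le> 2 * depth \<kappa> (Y' - Z) * defect \<kappa> (Y' - Z) \<xi>"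
      unfolding \<xi>_def using d factor[OF that(1)] that(2) by (subst defect_cost) auto
    then show ?thesis using d by (simp add: zero_le_mult_iff)
  qed
  have q: "0 \<le> qform \<kappa> \<xi>" using kappa by (intro qform_nonneg) auto
  have "c * (1 - \<kappa>\<^sup>2) * (norm (Y1 - Y2))\<^sup>2 * (norm \<xi>)\<^sup>2 = c * (norm (Y1 - Y2))\<^sup>2 * ((1 - \<kappa>\<^sup>2) * (norm \<xi>)\<^sup>2)"
    by simp
  also have "\<dots> \<le> c * (norm (Y1 - Y2))\<^sup>2 * qform \<kappa> \<xi>"
    using qform_ge[of \<kappa> \<xi>] kappa c0 by (intro mult_left_mono) auto
  also have "\<dots> \<le> (1 - l) * defect \<kappa> (Y1 - Z) \<xi> + l * defect \<kappa> (Y2 - Z) \<xi> + c * (norm (Y1 - Y2))\<^sup>2 * qform \<kappa> \<xi>"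
    using df[OF Y(1)] df[OF Y(2)] below l by (auto simp: X_def)
  also have "\<dots> = ((1 - l) * curv \<kappa> (Y1 - Z) + l * curv \<kappa> (Y2 - Z) + c * (norm (Y1 - Y2))\<^sup>2) * qform \<kappa> \<xi>
      - snd \<xi> + slope \<kappa> (Yl - Z) \<bullet> fst \<xi>"
    unfolding defect_def Yl_def Ycurve_target(2)[OF Y Z l] by (simp add: algebra_simps inner_add_left)
  also have "\<dots> \<le> curv \<kappa> (Yl - Z) * qform \<kappa> \<xi> - snd \<xi> + slope \<kappa> (Yl - Z) \<bullet> fst \<xi>"
    using mult_right_mono[OF gain q] by (simp add: Yl_def)
  also have "\<dots> = defect \<kappa> (Yl - Z) \<xi>" by (simp add: defect_def)
  \<comment> \<open>The focus moves from the curve point to the target Y that is actually seen from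
    x.\<close>
  also have "\<dots> \<le> defect \<kappa> (Y - Z) \<xi> + (D / (\<gamma> * R)\<^sup>2 + slope_const) * norm (Y - Yl) * norm \<xi>"
    using defect_perturb[OF target_cyl(1)[OF YS Z] target_cyl(1)[OF YlS Z], of \<xi> D] D
    by (simp add: \<xi>_def X_def)
  also have "(D / (\<gamma> * R)\<^sup>2 + slope_const) * norm (Y - Yl) * norm \<xi> \<le> (D / (\<gamma> * R)\<^sup>2 + slope_const) * \<rho> * norm \<xi>"
  proof -
    have "0 \<le> D" using D norm_ge_zero order_trans by blast
    then have "0 \<le> D / (\<gamma> * R)\<^sup>2 + slope_const" using slope_const_pos by (intro add_nonneg_nonneg) auto
    then show ?thesis using near unfolding Yl_def by (intro mult_right_mono mult_left_mono) auto
  qed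
  also have "defect \<kappa> (Y - Z) \<xi> \<le> (4 / \<gamma> + 2 * D / (\<gamma> * R)) * G"
  proof -
    define r d where "r = norm (Y - Z)" and "d = depth \<kappa> (Y - Z)"
    define E where "E = norm (X - Y) + cost \<kappa> Z Y + \<kappa> * (snd Y - snd X)"
    have d: "0 < d" "\<gamma> * R \<le> d" "r / d \<le> 1 / \<gamma>"
      unfolding r_def d_def using depth_cone[OF target_cyl(1)[OF YS Z] gamma_pos R] by auto
    have XY: "norm (X - Y) \<le> r + D"
      using norm_triangle_ineq4[of "X - Z" "Y - Z"] D by (simp add: r_def X_def)
    have "\<kappa> * (snd Y - snd X) \<le> 1 * norm (X - Y)"
      using kappa up[OF YS] abs_snd_le_norm[of "Y - X"] by (intro mult_mono) (auto simp: norm_minus_commute)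
    moreover have "- (\<kappa> * snd (Y - Z)) \<le> 1 * r"
      using mult_le_abs_bound[OF kappa, of "- snd (Y - Z)" r] abs_snd_le_norm[of "Y - Z"]
      by (simp add: r_def abs_minus_commute right_diff_distrib)
    ultimately have E: "E \<le> 4 * r + 2 * D"
      using XY unfolding E_def cost_eq[of \<kappa> Z] r_def by linarith
    \<comment> \<open>Y supports u at x, so the graph point below Z is outside that ellipsoid; hence
      X costs at most 2 G more than Z.\<close>
    have "cost \<kappa> X Y \<le> cost \<kappa> (graph (fst Z)) Y"
      unfolding X_def by (rule refractor_cost[OF Yx zO])
    also have "\<dots> \<le> cost \<kappa> Z Y + 2 * norm (graph (fst Z) - Z)"
      by (rule cost_lipschitz[OF kappa])
    also have "norm (graph (fst Z) - Z) = G"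
      using gap by (cases Z) (simp add: G_def norm_prod_def)
    finally have "(cost \<kappa> X Y - cost \<kappa> Z Y) * E \<le> (2 * G) * E"
      using factor[OF YS] unfolding E_def by (intro mult_right_mono) auto
    also have "\<dots> \<le> (2 * G) * (4 * r + 2 * D)"
      using E gap by (intro mult_left_mono) (auto simp: G_def)
    finally have "2 * d * defect \<kappa> (Y - Z) \<xi> \<le> (2 * G) * (4 * r + 2 * D)"
      unfolding d_def \<xi>_def E_def using d by (subst defect_cost) (auto simp: d_def)
    \<comment> \<open>The distance r to the target has no upper bound here, but it enters only
      through r / d, which the cone controls.\<close>
    then have "defect \<kappa> (Y - Z) \<xi> \<le> G * (4 * (r / d) + 2 * D / d)"
      using d by (simp add: field_simps)
    also have "\<dots> \<le> G * (4 * (1 / \<gamma>) + 2 * D / (\<gamma> * R))"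
    proof -
      have "0 \<le> D" using D norm_ge_zero order_trans by blast
      then have "2 * D / d \<le> 2 * D / (\<gamma> * R)"
        using d gamma_pos R by (intro divide_left_mono) auto
      then show ?thesis
        using d gap by (intro mult_left_mono add_mono) (auto simp: G_def)
    qed
    finally show ?thesis by (simp add: algebra_simps)
  qed
  finally show ?thesis
    unfolding \<xi>_def X_def G_def by (simp add: algebra_simps)
qed

end

section \<open>Mass of balls and differentiability\<close>

text \<open>Above the threshold, a powr (1 - P) is at most T powr (1 - P), since 1 - P <= 0.\<close>

lemma le_plus_powr:
  fixes a T P :: real
  assumes "0 \<le> a" "0 < T" "1 \<le> P"
  shows "a \<le> T + T powr (1 - P) * a powr P"
proof (cases "a \<le> T")
  case True
  then show ?thesis using assms by (simp add: add_increasing2)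
next
  case False
  then have "a = a powr (1 - P) * a powr P"
    using assms by (simp add: powr_add[symmetric])
  also have "\<dots> \<le> T powr (1 - P) * a powr P"
    using False assms by (intro mult_right_mono powr_mono2') auto
  finally show ?thesis using assms by simp
qed

lemma emeasure_lebesgue_on_le_cball:
  fixes \<Omega> :: "'a::euclidean_space set"
  assumes "\<Omega> \<in> sets lebesgue" "A \<in> sets (lebesgue_on \<Omega>)" "A \<subseteq> cball z \<eta>" "0 \<le> \<eta>"
  shows "emeasure (lebesgue_on \<Omega>) A \<le> ennreal (unit_ball_vol (real DIM('a)) * \<eta> ^ DIM('a))"
proof -
  have "A \<subseteq> \<Omega>" using sets.sets_into_space[OF assms(2)] by simp
  then have "emeasure (lebesgue_on \<Omega>) A = emeasure lebesgue A"
    using assms(1) by (simp add: emeasure_restrict_space)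
  also have "\<dots> \<le> emeasure lebesgue (cball z \<eta>)"
    using assms(3) by (intro emeasure_mono) auto
  also have "\<dots> = emeasure lborel (cball z \<eta>)" by simp
  also have "\<dots> = ennreal (unit_ball_vol (real DIM('a)) * \<eta> ^ DIM('a))"
    using assms(4) by (rule emeasure_cball)
  finally show ?thesis .
qed

lemma conjugate_exponent:
  fixes p :: ereal and q :: real
  assumes pq: "1 / p + 1 / ereal q = 1" and p: "p > ereal N" and N: "1 \<le> N"
  shows "p = \<infinity> \<and> q = 1 \<or> (\<exists>P. p = ereal P \<and> N < P \<and> 1 / q = 1 - 1 / P)"
    and "0 < q" "N - 1 < N / q"
proof -
  \<comment> \<open>In \<open>ereal\<close>, 1 / 0 is \<infinity>, so q = 0 is excluded by the
    equation and not by convention.\<close>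
  have q0: "q \<noteq> 0"
  proof
    assume "q = 0"
    then have "1 / ereal q = \<infinity>" by (simp add: divide_ereal_def one_ereal_def[symmetric])
    moreover have "1 / p \<noteq> -\<infinity>"
      using p N by (cases p) (auto simp: divide_ereal_def one_ereal_def)
    ultimately have "1 / p + 1 / ereal q = \<infinity>" by simp
    with pq show False by simp
  qed
  have "p = \<infinity> \<and> q = 1 \<or> (\<exists>P. p = ereal P \<and> N < P \<and> 1 / q = 1 - 1 / P)"
  proof (cases p)
    case (real P)
    then have "N < P" using p by simp
    moreover have "1 / P + 1 / q = 1"
      using pq q0 real \<open>N < P\<close> N by (simp add: one_ereal_def)
    ultimately show ?thesis using real by auto
  next
    case PInf
    then have "1 / q = 1" using pq q0 by (simp add: one_ereal_def)
    then show ?thesis using PInf by simp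
  qed (use p in auto)
  then show *: "p = \<infinity> \<and> q = 1 \<or> (\<exists>P. p = ereal P \<and> N < P \<and> 1 / q = 1 - 1 / P)" .
  have "0 < 1 / q \<and> N - 1 < N * (1 / q)"
    using *
  proof
    assume "\<exists>P. p = ereal P \<and> N < P \<and> 1 / q = 1 - 1 / P"
    then obtain P where P: "N < P" "1 / q = 1 - 1 / P" by blast
    have "1 / P < 1" using P N by simp
    moreover have "N / P < 1" using P N by simp
    ultimately show ?thesis unfolding P(2) by (simp add: right_diff_distrib)
  qed simp
  then show "0 < q" "N - 1 < N / q" by (auto simp: zero_less_divide_iff)
qed

text \<open>Hoelder's inequality on a ball of radius \<open>\<eta>\<close>, obtained from \<open>le_plus_powr\<close> with
  the threshold \<open>T = \<eta> powr (- n / p)\<close>.\<close>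

lemma source_measure_cball_bound:
  fixes \<Omega> :: "(real^'n::finite) set" and f :: "real^'n \<Rightarrow> real" and q :: real and p :: ereal
  assumes Om: "open \<Omega>" and f0: "\<forall>x\<in>\<Omega>. f x \<ge> 0" and Lp: "in_Lp p \<Omega> f"
    and p: "p > ereal (real CARD('n))" and pq: "1 / p + 1 / ereal q = 1"
  obtains C where "0 < C" "\<And>A z \<eta>. \<lbrakk>A \<in> sets (source_measure \<Omega> f); A \<subseteq> cball z \<eta>; 0 < \<eta>\<rbrakk> \<Longrightarrow>
    emeasure (source_measure \<Omega> f) A \<le> ennreal (C * \<eta> powr (real CARD('n) / q))"
proof -
  define N where "N = real CARD('n)"
  define \<beta> where "\<beta> = unit_ball_vol N"
  let ?M = "lebesgue_on \<Omega>"
  have N: "1 \<le> N" using card_gt_0_iff[of "UNIV :: 'n set"] by (simp add: N_def Suc_leI)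
  have \<beta>: "0 \<le> \<beta>" by (simp add: \<beta>_def N_def)
  have OmL: "\<Omega> \<in> sets lebesgue" using Om by (simp add: lebesgue_openin)
  have meas: "f \<in> borel_measurable ?M" using Lp by (simp add: in_Lp_def)
  have dens: "emeasure (source_measure \<Omega> f) A = (\<integral>\<^sup>+x. ennreal (f x) * indicator A x \<partial>?M)"
    if "A \<in> sets (source_measure \<Omega> f)" for A
    using that meas unfolding source_measure_def by (subst emeasure_density) auto
  have vol: "emeasure ?M A \<le> ennreal (\<beta> * \<eta> powr N)"
    if "A \<in> sets (source_measure \<Omega> f)" "A \<subseteq> cball z \<eta>" "0 < \<eta>" for A z \<eta>
    using emeasure_lebesgue_on_le_cball[OF OmL, of A z \<eta>] that
    by (simp add: source_measure_def \<beta>_def N_def powr_realpow)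
  have mA: "A \<in> sets ?M" if "A \<in> sets (source_measure \<Omega> f)" for A
    using that by (simp add: source_measure_def)
  from conjugate_exponent(1)[OF pq p[folded N_def] N] show thesis
  proof
    assume inf: "p = \<infinity> \<and> q = 1"
    then obtain K where K: "AE x in ?M. \<bar>f x\<bar> \<le> K" using Lp by (auto simp: in_Lp_def)
    define K' where "K' = max K 1"
    have "emeasure (source_measure \<Omega> f) A \<le> ennreal ((K' * \<beta> + 1) * \<eta> powr (real CARD('n) / q))"
      if A: "A \<in> sets (source_measure \<Omega> f)" "A \<subseteq> cball z \<eta>" "0 < \<eta>" for A z \<eta>
    proof -
      have "emeasure (source_measure \<Omega> f) A \<le> (\<integral>\<^sup>+x. ennreal K' * indicator A x \<partial>?M)"
        unfolding dens[OF A(1)]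
      proof (rule nn_integral_mono_AE)
        show "AE x in ?M. ennreal (f x) * indicator A x \<le> ennreal K' * indicator A x"
          using K by eventually_elim (auto simp: K'_def indicator_def intro!: ennreal_leI)
      qed
      also have "\<dots> = ennreal K' * emeasure ?M A"
        using mA[OF A(1)] by (simp add: nn_integral_cmult_indicator)
      also have "\<dots> \<le> ennreal K' * ennreal (\<beta> * \<eta> powr N)"
        using vol[OF A] by (rule mult_left_mono) simp
      also have "\<dots> = ennreal (K' * (\<beta> * \<eta> powr N))"
        by (intro ennreal_mult[symmetric]) (auto simp: K'_def \<beta>)
      also have "\<dots> \<le> ennreal ((K' * \<beta> + 1) * \<eta> powr (real CARD('n) / q))"
        using inf by (intro ennreal_leI) (simp add: N_def distrib_right)
      finally show ?thesis .
    qed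
    moreover have "0 < K' * \<beta> + 1" using \<beta> by (intro add_nonneg_pos) (auto simp: K'_def)
    ultimately show thesis using that by blast
  next
    assume "\<exists>P. p = ereal P \<and> N < P \<and> 1 / q = 1 - 1 / P"
    then obtain P where P: "p = ereal P" "N < P" "1 / q = 1 - 1 / P" by blast
    have P1: "1 \<le> P" using P N by simp
    have int: "integrable ?M (\<lambda>x. \<bar>f x\<bar> powr P)" using Lp P by (simp add: in_Lp_def)
    define J where "J = integral\<^sup>L ?M (\<lambda>x. \<bar>f x\<bar> powr P)"
    have J0: "0 \<le> J" by (simp add: J_def)
    have J: "(\<integral>\<^sup>+x. ennreal (\<bar>f x\<bar> powr P) \<partial>?M) = ennreal J"
      unfolding J_def by (rule nn_integral_eq_integral[OF int]) simp
    have "emeasure (source_measure \<Omega> f) A \<le> ennreal ((\<beta> + J + 1) * \<eta> powr (real CARD('n) / q))"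
      if A: "A \<in> sets (source_measure \<Omega> f)" "A \<subseteq> cball z \<eta>" "0 < \<eta>" for A z \<eta>
    proof -
      define T where "T = \<eta> powr (- N / P)"
      have T: "0 < T" using A by (simp add: T_def)
      have nq: "N / q = N - N / P"
        using P(3) by (metis mult.right_neutral right_diff_distrib times_divide_eq_right)
      \<comment> \<open>With this threshold both parts of the splitting scale like \<eta> powr (N /
        q).\<close>
      have e1: "T * \<eta> powr N = \<eta> powr (N / q)"
        unfolding T_def powr_add[symmetric] nq by simp
      have e2: "T powr (1 - P) = \<eta> powr (N / q)"
      proof -
        have "(- N / P) * (1 - P) = N - N / P" using P1 by (simp add: field_simps)
        then show ?thesis unfolding T_def powr_powr nq by simp
      qed
      have "emeasure (source_measure \<Omega> f) A
          \<le> (\<integral>\<^sup>+x. ennreal T * indicator A x + ennreal (T powr (1 - P)) * ennreal (\<bar>f x\<bar> powr P) \<partial>?M)"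
        unfolding dens[OF A(1)]
      proof (rule nn_integral_mono)
        fix x assume "x \<in> space ?M"
        then have fx: "0 \<le> f x" using f0 by simp
        have "ennreal (f x) \<le> ennreal (T + T powr (1 - P) * \<bar>f x\<bar> powr P)"
          using le_plus_powr[OF fx T P1] fx by (intro ennreal_leI) simp
        also have "\<dots> = ennreal T + ennreal (T powr (1 - P)) * ennreal (\<bar>f x\<bar> powr P)"
          using T by (simp add: ennreal_plus ennreal_mult)
        finally show "ennreal (f x) * indicator A x
            \<le> ennreal T * indicator A x + ennreal (T powr (1 - P)) * ennreal (\<bar>f x\<bar> powr P)"
          by (simp add: indicator_def)
      qed
      also have "\<dots> = ennreal T * emeasure ?M A + ennreal (T powr (1 - P)) * ennreal J"
        using mA[OF A(1)] meas
        by (simp add: nn_integral_add nn_integral_cmult nn_integral_cmult_indicator J)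
      also have "\<dots> \<le> ennreal T * ennreal (\<beta> * \<eta> powr N) + ennreal (T powr (1 - P)) * ennreal J"
        by (intro add_right_mono mult_left_mono vol[OF A]) simp
      also have "\<dots> = ennreal (T * (\<beta> * \<eta> powr N) + T powr (1 - P) * J)"
        using T \<beta> J0 by (simp add: ennreal_plus ennreal_mult)
      also have "T * (\<beta> * \<eta> powr N) + T powr (1 - P) * J = (\<beta> + J) * \<eta> powr (N / q)"
        using e1 e2 by (simp add: algebra_simps)
      also have "ennreal ((\<beta> + J) * \<eta> powr (N / q)) \<le> ennreal ((\<beta> + J + 1) * \<eta> powr (real CARD('n) / q))"
        by (intro ennreal_leI) (simp add: N_def distrib_right)
      finally show ?thesis .
    qed
    moreover have "0 < \<beta> + J + 1" using \<beta> J0 by simp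
    ultimately show thesis using that by blast
  qed
qed

text \<open>Multiplying by D powr A collects all powers of D on the left, with exponent 1 + 3 B + A.
  It is used with A = n / (2 q) and B = (n - 1) / 2.\<close>

lemma powr_exponent_balance:
  fixes D d c C A B :: real
  assumes pos: "0 < D" "0 < d" "0 < c" "0 < C" and E: "0 < 1 + 3 * B + A"
    and le: "c * (D powr (3 * B) * d powr B) * D \<le> C * (d / D) powr A"
  shows "D \<le> (C / c) powr (1 / (1 + 3 * B + A)) * d powr ((A - B) / (1 + 3 * B + A))"
proof -
  define E' where "E' = 1 + 3 * B + A"
  have "D powr E' * d powr B = D powr (3 * B) * d powr B * D * D powr A"
    using pos by (simp add: E'_def powr_add)
  also have "\<dots> \<le> (C / c) * (d / D) powr A * D powr A"
    using le pos by (intro mult_right_mono) (auto simp: field_simps)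
  also have "\<dots> = (C / c) * d powr (A - B) * d powr B"
    using pos by (simp add: powr_divide powr_add[symmetric])
  finally have "D powr E' \<le> (C / c) * d powr (A - B)"
    using pos by (simp add: field_simps)
  then have "(D powr E') powr (1 / E') \<le> ((C / c) * d powr (A - B)) powr (1 / E')"
    using E by (intro powr_mono2) (auto simp: E'_def)
  moreover have "((C / c) * d powr (A - B)) powr (1 / E') = (C / c) powr (1 / E') * d powr ((A - B) / E')"
    using pos powr_mult[of "C / c" "d powr (A - B)" "1 / E'"] by (simp add: powr_powr)
  moreover have "(D powr E') powr (1 / E') = D"
    using pos E by (simp add: powr_powr E'_def)
  ultimately show ?thesis by (simp only: E'_def)
qed

text \<open>The bound at x is one half of differentiability. Exchanging x and y gives a lower bound
  with \<open>Du y\<close> in place of \<open>Du x\<close>, and by the Hoelder estimate the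
  replacement costs only |y - x| powr (1 + \<alpha>).\<close>

lemma GDERIV_of_tangent_upper_bound:
  fixes u :: "'a::real_inner \<Rightarrow> real"
  assumes B: "open B" "x \<in> B" and \<alpha>: "0 < \<alpha>"
    and upper: "\<And>x y. x \<in> B \<Longrightarrow> y \<in> B \<Longrightarrow> u y \<le> u x + Du x \<bullet> (y - x) + K * (norm (y - x))\<^sup>2"
    and holder: "\<And>y. y \<in> B \<Longrightarrow> norm (Du y - Du x) \<le> C * norm (y - x) powr \<alpha>"
  shows "GDERIV u x :> Du x"
  unfolding gderiv_def has_derivative_at_alt
proof (intro conjI allI impI)
  show "bounded_linear (\<lambda>h. h \<bullet> Du x)" by (rule bounded_linear_inner_left)
  fix e :: real assume e: "0 < e"
  obtain r where r: "0 < r" "ball x r \<subseteq> B" using B openE by blast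
  have "((\<lambda>t. \<bar>K\<bar> * t + \<bar>C\<bar> * t powr \<alpha>) \<longlongrightarrow> \<bar>K\<bar> * 0 + \<bar>C\<bar> * 0 powr \<alpha>) (at_right 0)"
    using \<alpha> eventually_mono[OF eventually_at_right_less[of "0::real"] less_imp_le]
    by (intro tendsto_intros tendsto_powr') auto
  then have "eventually (\<lambda>t. \<bar>K\<bar> * t + \<bar>C\<bar> * t powr \<alpha> < e) (at_right 0)"
    using e by (intro order_tendstoD(2)) auto
  then obtain b where b: "0 < b" "\<And>t. 0 < t \<Longrightarrow> t < b \<Longrightarrow> \<bar>K\<bar> * t + \<bar>C\<bar> * t powr \<alpha> < e"
    by (auto simp: eventually_at_right_field)
  show "\<exists>d>0. \<forall>y. norm (y - x) < d \<longrightarrow> norm (u y - u x - (y - x) \<bullet> Du x) \<le> e * norm (y - x)"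
  proof (intro exI[of _ "min r b"] conjI allI impI)
    show "0 < min r b" using r b by simp
    fix y assume y: "norm (y - x) < min r b"
    show "norm (u y - u x - (y - x) \<bullet> Du x) \<le> e * norm (y - x)"
    proof (cases "y = x")
      case False
      define t where "t = norm (y - x)"
      have t: "0 < t" "t < b" "t < r" using False y by (auto simp: t_def)
      have yB: "y \<in> B" using r t by (auto simp: t_def dist_norm norm_minus_commute subset_iff)
      have 1: "u y - u x - (y - x) \<bullet> Du x \<le> K * t\<^sup>2"
        using upper[OF B(2) yB] by (simp add: t_def inner_commute)
      have "u x - u y \<le> Du y \<bullet> (x - y) + K * t\<^sup>2"
        using upper[OF yB B(2)] by (simp add: t_def norm_minus_commute)
      also have "Du y \<bullet> (x - y) = - (Du x \<bullet> (y - x)) + (Du x - Du y) \<bullet> (y - x)"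
        by (simp add: inner_diff algebra_simps)
      also have "(Du x - Du y) \<bullet> (y - x) \<le> norm (Du x - Du y) * t"
        unfolding t_def by (rule norm_cauchy_schwarz)
      also have "\<dots> \<le> (C * t powr \<alpha>) * t"
        using holder[OF yB] t by (intro mult_right_mono) (auto simp: t_def norm_minus_commute)
      finally have 2: "- (u y - u x - (y - x) \<bullet> Du x) \<le> (C * t powr \<alpha>) * t + K * t\<^sup>2"
        by (simp add: inner_commute)
      have "K * t\<^sup>2 \<le> (\<bar>K\<bar> * t) * t" "(C * t powr \<alpha>) * t \<le> (\<bar>C\<bar> * t powr \<alpha>) * t" "0 \<le> (\<bar>C\<bar> * t powr \<alpha>) * t"
        using t by (auto simp: power2_eq_square mult.assoc intro!: mult_right_mono)
      with 1 2 have "\<bar>u y - u x - (y - x) \<bullet> Du x\<bar> \<le> (\<bar>K\<bar> * t + \<bar>C\<bar> * t powr \<alpha>) * t"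
        unfolding distrib_right by linarith
      also have "\<dots> \<le> e * t" using b(2)[OF t(1,2)] t by (intro mult_right_mono) auto
      finally show ?thesis by (simp add: t_def)
    qed simp
  qed
qed

section \<open>Hoelder continuity of the target map\<close>

text \<open>If h > \<tau>, one factor \<tau> of the last term may be replaced by h, and h can be
  divided out.\<close>

lemma scaled_quadratic_bound:
  fixes a b c h \<tau> :: real
  assumes a: "0 < a" and nn: "0 \<le> b" "0 \<le> c" and \<tau>: "0 < \<tau>"
    and le: "a * h\<^sup>2 \<le> b * \<tau> * h + c * \<tau>\<^sup>2"
  shows "h \<le> (1 + (b + c) / a) * \<tau>"
proof (cases "h \<le> \<tau>")
  case True
  moreover have "0 \<le> (b + c) / a * \<tau>" using assms by simp
  ultimately show ?thesis unfolding distrib_right by simp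
next
  case False
  then have h: "0 < h" using \<tau> by simp
  have "c * \<tau>\<^sup>2 \<le> c * \<tau> * h"
    using False nn \<tau> by (simp add: power2_eq_square mult.assoc mult_left_mono)
  then have "(a * h) * h \<le> ((b + c) * \<tau>) * h"
    using le by (simp add: power2_eq_square algebra_simps)
  then have "a * h \<le> (b + c) * \<tau>" using h by simp
  then have "h \<le> (b + c) / a * \<tau>" using a by (simp add: field_simps)
  then show ?thesis using \<tau> unfolding distrib_right by simp
qed

context refractor_setting
begin

lemma graph_diff_bound:
  assumes "\<And>x. x \<in> \<Omega> \<Longrightarrow> norm x \<le> B" "x \<in> \<Omega>" "Z \<in> cyl"
  shows "norm (graph x - Z) \<le> 2 * B + M0"
proof -
  have "norm (graph x - Z) \<le> norm (x - fst Z) + \<bar>u x - snd Z\<bar>"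
    using norm_Pair_le[of "x - fst Z" "u x - snd Z"] by (cases Z) simp
  moreover have "norm (x - fst Z) \<le> 2 * B"
    using norm_triangle_ineq4[of x "fst Z"] assms(1)[of x] assms(1)[of "fst Z"] assms(2,3)
    by (fastforce simp: cylinder_def)
  moreover have "\<bar>u x - snd Z\<bar> \<le> M0"
    using u_range[OF assms(2)] assms(3) by (auto simp: cylinder_def)
  ultimately show ?thesis by simp
qed

text \<open>Let d = |x2 - x1| and D = |Y1 - Y2|. If D < d, the claim follows from d <= 1 and
  \<alpha> <= 1. If d <= D, errors of order d^2 are absorbed in D d, and the balance of terms is
  carried out at the crossing point Z.\<close>

lemma target_map_holder:
  fixes q Cm :: real and f :: "real^'n \<Rightarrow> real" and \<sigma> :: "'n point measure"
  assumes dim: "CARD('n) \<ge> 2" and bdd: "bounded \<Omega>"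
    and q: "0 < q" "real CARD('n) - 1 < real CARD('n) / q"
    and borel: "sets \<sigma> = sets (restrict_space borel S)"
    and solution: "refractor_solution \<kappa> \<Omega> S f \<sigma> u"
    and Cm: "0 < Cm" "\<And>A z \<eta>. \<lbrakk>A \<in> sets (source_measure \<Omega> f); A \<subseteq> cball z \<eta>; 0 < \<eta>\<rbrakk> \<Longrightarrow>
      emeasure (source_measure \<Omega> f) A \<le> ennreal (Cm * \<eta> powr (real CARD('n) / q))"
    and xs: "xs \<in> \<Omega>"
    and regular: "regular_from \<kappa> M0 \<Omega> S s (graph xs)"
    and tube: "tube_condition \<kappa> M0 \<Omega> S s \<sigma> (graph xs)"
    and \<alpha>: "\<alpha> = (real CARD('n) / (2 * q) - (real CARD('n) - 1) / 2) /
       (1 + 3 / 2 * (real CARD('n) - 1) + real CARD('n) / (2 * q))"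
  obtains \<delta> C where "0 < \<delta>" "2 * \<delta> \<le> 1" "0 < C" "ball xs \<delta> \<subseteq> \<Omega>"
    "\<And>x1 x2 Y1 Y2. \<lbrakk>x1 \<in> ball xs \<delta>; x2 \<in> ball xs \<delta>; x1 \<noteq> x2; Y1 \<in> F x1; Y2 \<in> F x2\<rbrakk> \<Longrightarrow>
      norm (Y1 - Y2) \<le> C * norm (x2 - x1) powr \<alpha>"
proof -
  define N A B where "N = real CARD('n)" and "A = N / (2 * q)" and "B = (N - 1) / 2"
  have N: "2 \<le> N" using dim by (simp add: N_def)
  have B: "0 < B" using N by (simp add: B_def)
  have AB: "B < A" using q(2) by (simp add: A_def B_def N_def)
  have \<alpha>': "\<alpha> = (A - B) / (1 + 3 * B + A)"
    unfolding \<alpha> A_def B_def N_def by simp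
  have \<alpha>1: "\<alpha> \<le> 1" using AB B unfolding \<alpha>' by (simp add: field_simps)
  obtain U1 c1 c2 where U1: "open U1" "graph xs \<in> U1" "U1 \<subseteq> cyl" "0 < c1" "0 < c2"
    and reg: "\<And>Y1 Y2 Z l x. \<lbrakk>Y1 \<in> S; Y2 \<in> S; Z \<in> U1; l \<in> {1/4..3/4}; x \<in> \<Omega>; norm (x - fst Z) \<le> c2\<rbrakk> \<Longrightarrow>
        phi \<kappa> x (Ycurve \<kappa> s Z Y1 Y2 l) Z
          \<ge> min (phi \<kappa> x Y1 Z) (phi \<kappa> x Y2 Z) + c1 * (norm (Y1 - Y2))\<^sup>2 * (norm (x - fst Z))\<^sup>2"
    using regular unfolding regular_from_def by blast
  obtain U2 ct \<rho>0 where U2: "open U2" "graph xs \<in> U2" "0 < ct" "0 < \<rho>0"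
    and tub: "\<And>Y1 Y2 Z \<rho>. \<lbrakk>Y1 \<in> S; Y2 \<in> S; Z \<in> U2; 0 < \<rho>; \<rho> < \<rho>0\<rbrakk> \<Longrightarrow>
        emeasure \<sigma> (nbhd_of_set \<rho> (Ycurve \<kappa> s Z Y1 Y2 ` {1/4..3/4}) \<inter> S)
          \<ge> ennreal (ct * \<rho> ^ (CARD('n) - 1) * norm (Y1 - Y2))"
    using tube unfolding tube_condition_def by (elim exE conjE) (rule that, assumption+, simp)
  define c where "c = curv_gain c1"
  have gR: "0 < \<gamma> * R" using gamma_pos R by simp
  have c: "0 < c"
    unfolding c_def curv_gain_def using U1(4)
    by (intro divide_pos_pos mult_pos_pos add_pos_nonneg) auto
  have gain: "(1 - l) * curv \<kappa> (Y1 - Z) + l * curv \<kappa> (Y2 - Z) + c * (norm (Y1 - Y2))\<^sup>2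
      \<le> curv \<kappa> (Ycurve \<kappa> s Z Y1 Y2 l - Z)"
    if "Y1 \<in> S" "Y2 \<in> S" "Z \<in> U1" "l \<in> {1/4..3/4}" for Y1 Y2 Z l
    unfolding c_def using that U1 by (intro curv_regular[OF dim _ _ _ _ U1(4,5) reg]) auto
  define m where "m = 1 / (2 * (\<gamma> * R))"
  \<comment> \<open>The curvature inequality bounds the diameter of the target, because c |Y1 -
    Y2|^2 is at most a curvature. Hence a small d alone makes the tube radius small.\<close>
  define DS where "DS = sqrt (m / c)"
  have DS: "norm (Y1 - Y2) \<le> DS" if Y: "Y1 \<in> S" "Y2 \<in> S" for Y1 Y2
  proof -
    let ?Z = "graph xs"
    have Z: "?Z \<in> cyl" using U1 by blast
    have Yl: "Ycurve \<kappa> s ?Z Y1 Y2 (1/2) \<in> S" by (rule Ycurve_target[OF Y Z]) auto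
    note cc = curv_cone[OF target_cyl(1)[OF _ Z] gamma_pos R]
    have "c * (norm (Y1 - Y2))\<^sup>2 \<le> m"
      using gain[OF Y U1(2), of "1/2"] cc(1)[OF Y(1)] cc(1)[OF Y(2)] cc(2)[OF Yl] unfolding m_def by auto
    then have "(norm (Y1 - Y2))\<^sup>2 \<le> m / c" using c by (simp add: field_simps)
    then show ?thesis unfolding DS_def by (rule real_le_rsqrt)
  qed
  obtain Bd where Bd: "\<And>x. x \<in> \<Omega> \<Longrightarrow> norm x \<le> Bd" using bdd by (auto simp: bounded_iff)
  define Dm where "Dm = 2 * Bd + M0"
  have Dm: "norm (graph x - Z) \<le> Dm" if "x \<in> \<Omega>" "Z \<in> cyl" for x Z
    unfolding Dm_def using Bd that by (rule graph_diff_bound)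
  have Dm0: "0 \<le> Dm" using Dm[OF xs, of "graph xs"] U1 by auto
  define L1 L2 L3 a S0 where "L1 = Dm / (\<gamma> * R)\<^sup>2 + slope_const" and "L2 = 4 / \<gamma> + 2 * Dm / (\<gamma> * R)"
    and "L3 = L2 * (slope_const + tangent_const)" and "a = c * (1 - \<kappa>\<^sup>2)" and "S0 = 1 + (L1 + L3) / a"
  have L: "0 \<le> L1" "0 \<le> L2"
    using Dm0 slope_const_pos gamma_pos gR unfolding L1_def L2_def by (auto intro!: add_nonneg_nonneg divide_nonneg_pos)
  have L3: "0 \<le> L3" using L slope_const_pos tangent_const_pos by (simp add: L3_def)
  have a0: "0 < a" using c kappa by (simp add: a_def abs_square_less_1)
  have S0: "0 < S0" using L L3 a0 by (simp add: S0_def add_pos_nonneg)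
  obtain r where r: "0 < r" "ball (graph xs) r \<subseteq> U1 \<inter> U2"
    using openE[OF open_Int[OF U1(1) U2(1)] IntI[OF U1(2) U2(2)]] .
  obtain r' where r': "0 < r'" "ball xs r' \<subseteq> \<Omega>" using open_\<Omega> xs openE by blast
  define \<rho>1 where "\<rho>1 = \<rho>0 / (DS powr (3/2) + 1)"
  have \<rho>1: "0 < \<rho>1" using U2 by (simp add: \<rho>1_def add_nonneg_pos)
  \<comment> \<open>1/2 gives d <= 1; r' keeps the ball in \<Omega>; the third bound puts Z into
    both neighbourhoods, its height differing from \<open>u xs\<close> by at most \<delta> /
    \<gamma> + 2 \<delta> / \<gamma>; the last one forces \<rho> < \<rho>0.\<close>
  define \<delta> where "\<delta> = min (min (1/2) r') (min (r / (2 * (1 + 3 / \<gamma>))) (\<rho>1\<^sup>2 / 4))"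
  have \<delta>: "0 < \<delta>" "2 * \<delta> \<le> 1" "\<delta> \<le> r'" "\<delta> * (1 + 3 / \<gamma>) < r" "2 * \<delta> < \<rho>1\<^sup>2"
  proof -
    show d: "0 < \<delta>" unfolding \<delta>_def using r r' \<rho>1 gamma_pos by (simp add: add_pos_pos)
    show "2 * \<delta> \<le> 1" "\<delta> \<le> r'" unfolding \<delta>_def by auto
    have e: "0 < 1 + 3 / \<gamma>" using gamma_pos by (simp add: add_pos_pos)
    have "\<delta> \<le> r / (2 * (1 + 3 / \<gamma>))" unfolding \<delta>_def by auto
    then have "\<delta> * (2 * (1 + 3 / \<gamma>)) \<le> r" using e by (subst (asm) pos_le_divide_eq) auto
    moreover have "0 < \<delta> * (1 + 3 / \<gamma>)" using d e by (rule mult_pos_pos)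
    moreover have "y < r" if "2 * y \<le> r" "0 < y" for y using that by simp
    ultimately show "\<delta> * (1 + 3 / \<gamma>) < r" unfolding mult.left_commute[of \<delta> 2] by blast
    have "\<delta> \<le> \<rho>1\<^sup>2 / 4"
      unfolding \<delta>_def by (rule order_trans[OF min.cobounded2 min.cobounded2])
    moreover have "0 < \<rho>1\<^sup>2" using \<rho>1 by simp
    ultimately show "2 * \<delta> < \<rho>1\<^sup>2" by linarith
  qed
  have ball: "ball xs \<delta> \<subseteq> \<Omega>" using r' \<delta>(3) by (auto simp: subset_iff)
  define C1 where "C1 = (Cm * S0 powr (2 * A) / ct) powr (1 / (1 + 3 * B + A))"
  have main: "norm (Y1 - Y2) \<le> (1 + C1) * norm (x2 - x1) powr \<alpha>"
    if x: "x1 \<in> ball xs \<delta>" "x2 \<in> ball xs \<delta>" "x1 \<noteq> x2" and Y: "Y1 \<in> F x1" "Y2 \<in> F x2" for x1 x2 Y1 Y2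
  proof -
    define d D where "d = norm (x2 - x1)" and "D = norm (Y1 - Y2)"
    have d0: "0 < d" using x(3) by (simp add: d_def)
    have d2: "d < 2 * \<delta>"
      using x norm_triangle_ineq4[of "x2 - xs" "x1 - xs"] by (simp add: d_def dist_norm norm_minus_commute)
    have d1: "d \<le> 1" using d2 \<delta> by simp
    have xO: "x1 \<in> \<Omega>" "x2 \<in> \<Omega>" using x ball by auto
    note YS = F_target[OF Y(1)] F_target[OF Y(2)]
    have C1: "0 \<le> C1" by (simp add: C1_def)
    show ?thesis
    proof (cases "D < d")
      case True
      have "D \<le> d powr 1" using True d0 by simp
      also have "\<dots> \<le> d powr \<alpha>" using d0 d1 \<alpha>1 by (intro powr_mono') auto
      also have "\<dots> \<le> (1 + C1) * d powr \<alpha>" using C1 by (simp add: distrib_right)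
      finally show ?thesis by (simp add: D_def d_def)
    next
      case False
      then have D: "d \<le> D" "0 < D" using d0 by auto
      have seg: "closed_segment x1 x2 \<subseteq> ball xs \<delta>"
        using x by (intro closed_segment_subset) auto
      obtain l t where l: "l \<in> {0..1}" and t: "u ((1 - l) *\<^sub>R x1 + l *\<^sub>R x2) \<le> t"
        "t \<le> u x1 + norm (x2 - x1) / \<gamma>"
        and cost: "cost \<kappa> ((1 - l) *\<^sub>R x1 + l *\<^sub>R x2, t) Y1 = cost \<kappa> (graph x1) Y1"
        "cost \<kappa> ((1 - l) *\<^sub>R x1 + l *\<^sub>R x2, t) Y2 = cost \<kappa> (graph x2) Y2"
        using supporting_ellipsoids_cross[OF xO _ Y] seg ball by blast
      define z where "z = (1 - l) *\<^sub>R x1 + l *\<^sub>R x2"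
      define Z where "Z = (z, t)"
      have zb: "z \<in> ball xs \<delta>" using seg l by (auto simp: z_def closed_segment_def)
      have zO: "z \<in> \<Omega>" using zb ball by auto
      have ZU: "Z \<in> U1 \<inter> U2"
      proof -
        have zd: "norm (z - xs) < \<delta>" and xd: "norm (x1 - xs) < \<delta>"
          using zb x by (auto simp: dist_norm norm_minus_commute)
        have "\<bar>u z - u xs\<bar> \<le> \<delta> / \<gamma>"
          using u_lipschitz[OF zO xs] divide_right_mono[OF less_imp_le[OF zd], of \<gamma>] gamma_pos by simp
        moreover have "\<bar>u x1 - u xs\<bar> \<le> \<delta> / \<gamma>"
          using u_lipschitz[OF xO(1) xs] divide_right_mono[OF less_imp_le[OF xd], of \<gamma>] gamma_pos by simp
        moreover have "d / \<gamma> \<le> 2 * (\<delta> / \<gamma>)" using divide_right_mono[OF less_imp_le[OF d2], of \<gamma>] gamma_pos by simp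
        ultimately have "\<bar>t - u xs\<bar> \<le> 3 * (\<delta> / \<gamma>)" using t unfolding z_def[symmetric] d_def[symmetric] by linarith
        moreover have "norm (Z - graph xs) \<le> norm (z - xs) + \<bar>t - u xs\<bar>"
          using norm_Pair_le[of "z - xs" "t - u xs"] by (simp add: Z_def)
        ultimately have "norm (Z - graph xs) < \<delta> + 3 * (\<delta> / \<gamma>)" using zd by linarith
        also have "\<dots> = \<delta> * (1 + 3 / \<gamma>)" by (simp add: distrib_left)
        finally have "Z \<in> ball (graph xs) r" using \<delta>(4) by (simp add: dist_norm norm_minus_commute)
        then show ?thesis using r by blast
      qed
      have Zc: "Z \<in> cyl" using ZU U1 by blast
      have gap: "t - u z \<le> (slope_const + tangent_const) * (D * d)"
      proof -
        have "norm (slope \<kappa> (Y1 - Z) - slope \<kappa> (Y2 - Z)) \<le> slope_const * D"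
          using slope_lipschitz[OF target_cyl(1)[OF YS(1) Zc] target_cyl(1)[OF YS(2) Zc] gamma_pos R kappa]
          by (simp add: slope_const_def D_def)
        then have "norm (slope \<kappa> (Y1 - Z) - slope \<kappa> (Y2 - Z)) * d \<le> (slope_const * D) * d"
          using d0 by (intro mult_right_mono) auto
        moreover have "tangent_const * d\<^sup>2 \<le> tangent_const * (D * d)"
          unfolding power2_eq_square using tangent_const_pos D d0 by (intro mult_left_mono mult_right_mono) auto
        moreover have "t - u z \<le> norm (slope \<kappa> (Y1 - Z) - slope \<kappa> (Y2 - Z)) * d + tangent_const * d\<^sup>2"
          unfolding d_def Z_def using crossing_gap[OF xO YS l z_def _ cost[folded z_def]] Zc by (simp add: Z_def)
        ultimately show ?thesis by (simp add: algebra_simps)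
      qed
      \<comment> \<open>\<tau> is the distance scale h of the balance; the next fact records that
        D^2 \<tau>^2, \<rho> \<tau> and D d coincide.\<close>
      define \<rho> \<tau> where "\<rho> = D powr (3/2) * d powr (1/2)" and "\<tau> = (d / D) powr (1/2)"
      have \<tau>: "0 < \<tau>" using d0 D by (simp add: \<tau>_def)
      have Dd: "D\<^sup>2 * \<tau>\<^sup>2 = D * d" "\<rho> * \<tau> = D * d" "D\<^sup>2 * \<tau> = \<rho>"
      proof -
        have t2: "\<tau>\<^sup>2 = d / D" unfolding \<tau>_def using d0 D by (simp add: powr_half_sqrt)
        then show "D\<^sup>2 * \<tau>\<^sup>2 = D * d" using D by (simp add: power2_eq_square)
        have "D\<^sup>2 = D powr 2" using D by simp
        then show 3: "D\<^sup>2 * \<tau> = \<rho>"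
          unfolding \<tau>_def \<rho>_def using D d0
          by (simp add: powr_divide powr_diff[symmetric] field_simps powr_add[symmetric])
        show "\<rho> * \<tau> = D * d"
          unfolding 3[symmetric] using \<open>D\<^sup>2 * \<tau>\<^sup>2 = D * d\<close> by (simp add: power2_eq_square)
      qed
      have \<rho>: "0 < \<rho>" "\<rho> < \<rho>0"
      proof -
        show "0 < \<rho>" using d0 D by (simp add: \<rho>_def)
        have "D \<le> DS" unfolding D_def by (rule DS[OF YS])
        then have "D powr (3/2) \<le> DS powr (3/2)" using D by (intro powr_mono2) auto
        moreover have "d powr (1/2) < \<rho>1"
        proof -
          have "d < \<rho>1\<^sup>2" using d2 \<delta>(5) by simp
          then have "sqrt d < sqrt (\<rho>1\<^sup>2)" by (rule real_sqrt_less_mono)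
          then show ?thesis using d0 \<rho>1 by (simp add: powr_half_sqrt)
        qed
        ultimately have "\<rho> \<le> DS powr (3/2) * \<rho>1"
          unfolding \<rho>_def by (intro mult_mono) auto
        also have "\<dots> < (DS powr (3/2) + 1) * \<rho>1" using \<rho>1 by (simp add: distrib_right)
        also have "\<dots> = \<rho>0"
        proof -
          have "0 < DS powr (3/2) + 1" by (simp add: add_nonneg_pos)
          then show ?thesis unfolding \<rho>1_def by simp
        qed
        finally show "\<rho> < \<rho>0" .
      qed
      define E where "E = nbhd_of_set \<rho> (Ycurve \<kappa> s Z Y1 Y2 ` {1/4..3/4}) \<inter> S"
      \<comment> \<open>The tube is a union of open balls, so its trace on S is Borel whatever the
        curve is.\<close>
      have Es: "E \<in> sets \<sigma>"
      proof -
        have "open (nbhd_of_set \<rho> (Ycurve \<kappa> s Z Y1 Y2 ` {1/4..3/4}))"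
          unfolding nbhd_of_set_def by auto
        then show ?thesis unfolding E_def borel by (auto simp: sets_restrict_space)
      qed
      have tr: "tracing \<kappa> \<Omega> S u E \<subseteq> cball z (S0 * \<tau>)"
      proof
        fix x assume "x \<in> tracing \<kappa> \<Omega> S u E"
        then obtain Y' where x': "x \<in> \<Omega>" and Y': "Y' \<in> F x" "Y' \<in> E" by (auto simp: tracing_def)
        obtain l' where l': "l' \<in> {1/4..3/4}" "dist (Ycurve \<kappa> s Z Y1 Y2 l') Y' < \<rho>"
          using Y'(2) by (auto simp: E_def nbhd_of_set_def)
        define h where "h = norm (graph x - Z)"
        have "a * D\<^sup>2 * h\<^sup>2 \<le> L1 * \<rho> * h + L2 * (snd Z - u (fst Z))"
          unfolding a_def D_def h_def L1_def L2_def
        proof (rule contact_near_crossing[OF YS Zc, of l'])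
          show "l' \<in> {0..1}" using l' by auto
          show "(1 - l') * curv \<kappa> (Y1 - Z) + l' * curv \<kappa> (Y2 - Z) + c * (norm (Y1 - Y2))\<^sup>2
              \<le> curv \<kappa> (Ycurve \<kappa> s Z Y1 Y2 l' - Z)"
            using gain[OF YS _ l'(1)] ZU by blast
          show "0 \<le> c" using c by simp
          show "cost \<kappa> Z Y1 \<le> cost \<kappa> (graph x) Y1" "cost \<kappa> Z Y2 \<le> cost \<kappa> (graph x) Y2"
            using refractor_cost[OF Y(1) x'] refractor_cost[OF Y(2) x'] cost by (auto simp: Z_def z_def)
          show "norm (Y' - Ycurve \<kappa> s Z Y1 Y2 l') \<le> \<rho>"
            using l'(2) by (simp add: dist_norm norm_minus_commute)
          show "norm (graph x - Z) \<le> Dm" using Dm[OF x' Zc] .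
          show "0 \<le> snd Z - u (fst Z)" using t(1) by (simp add: Z_def z_def)
        qed (use x' Y' in auto)
        also have "L2 * (snd Z - u (fst Z)) \<le> L2 * ((slope_const + tangent_const) * (D * d))"
          using gap L by (intro mult_left_mono) (auto simp: Z_def)
        \<comment> \<open>All three terms carry the factor D^2 by the choice of \<rho> and \<tau>;
          dividing it out leaves constants independent of D and d.\<close>
        finally have "D\<^sup>2 * (a * h\<^sup>2) \<le> D\<^sup>2 * (L1 * \<tau> * h + L3 * \<tau>\<^sup>2)"
          unfolding L3_def Dd(1)[symmetric] Dd(3)[symmetric] by (simp add: algebra_simps)
        then have "a * h\<^sup>2 \<le> L1 * \<tau> * h + L3 * \<tau>\<^sup>2" using D by simp
        then have "h \<le> S0 * \<tau>" unfolding S0_def by (rule scaled_quadratic_bound[OF a0 L(1) L3 \<tau>])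
        moreover have "norm (x - z) \<le> h"
          using norm_fst_le_norm[of "graph x - Z"] by (simp add: h_def Z_def)
        ultimately show "x \<in> cball z (S0 * \<tau>)" by (simp add: dist_norm norm_minus_commute)
      qed
      have "ennreal (ct * \<rho> ^ (CARD('n) - 1) * D) \<le> emeasure \<sigma> E"
        unfolding E_def D_def using tub[OF YS _ \<rho>] ZU by blast
      also have "\<dots> = emeasure (source_measure \<Omega> f) (tracing \<kappa> \<Omega> S u E)"
        using solution Es by (simp add: refractor_solution_def)
      also have "\<dots> \<le> ennreal (Cm * (S0 * \<tau>) powr (real CARD('n) / q))"
        using solution Es tr S0 \<tau> by (intro Cm(2)) (auto simp: refractor_solution_def)
      finally have le: "ct * \<rho> ^ (CARD('n) - 1) * D \<le> Cm * (S0 * \<tau>) powr (real CARD('n) / q)"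
        using Cm(1) by (subst (asm) ennreal_le_iff) auto
      have "\<rho> ^ (CARD('n) - 1) = \<rho> powr (N - 1)"
        using \<rho>(1) dim by (simp add: N_def powr_realpow[symmetric] of_nat_diff)
      also have "\<dots> = D powr (3 * B) * d powr B"
        unfolding \<rho>_def using D d0 by (simp add: powr_mult powr_powr B_def)
      finally have e1: "\<rho> ^ (CARD('n) - 1) = D powr (3 * B) * d powr B" .
      have "real CARD('n) / q = 2 * A" using q by (simp add: A_def N_def)
      then have e2: "(S0 * \<tau>) powr (real CARD('n) / q) = S0 powr (2 * A) * (d / D) powr A"
        using S0 \<tau> D d0 by (simp add: powr_mult) (simp add: \<tau>_def powr_powr)
      have "ct * (D powr (3 * B) * d powr B) * D \<le> (Cm * S0 powr (2 * A)) * (d / D) powr A"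
        using le unfolding e1 e2 by (simp add: mult.assoc)
      then have "D \<le> C1 * d powr \<alpha>"
        unfolding C1_def \<alpha>' using D d0 U2 Cm S0 B AB by (intro powr_exponent_balance) auto
      also have "\<dots> \<le> (1 + C1) * d powr \<alpha>" by (simp add: distrib_right)
      finally show ?thesis by (simp add: D_def d_def)
    qed
  qed
  have "0 < 1 + C1" by (simp add: C1_def add_pos_nonneg)
  from that[OF \<delta>(1,2) this ball main] show thesis .
qed

text \<open>Any selection of targets provides the gradient through \<open>slope\<close>, which is
  Lipschitz in Y - X. The motion of the base point contributes d + d / \<gamma>, which is dominated
  by d powr \<alpha> because the diameter 2 \<delta> is at most 1.\<close>

lemma refractor_C1_alpha:
  assumes \<delta>: "2 * \<delta> \<le> 1" "ball xs \<delta> \<subseteq> \<Omega>" and C: "0 < C" and \<alpha>: "0 < \<alpha>" "\<alpha> \<le> 1"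
    and holder: "\<And>x1 x2 Y1 Y2. \<lbrakk>x1 \<in> ball xs \<delta>; x2 \<in> ball xs \<delta>; x1 \<noteq> x2; Y1 \<in> F x1; Y2 \<in> F x2\<rbrakk> \<Longrightarrow>
      norm (Y1 - Y2) \<le> C * norm (x2 - x1) powr \<alpha>"
  shows "\<exists>C>0. C1_alpha_on \<alpha> C (ball xs \<delta>) u"
proof -
  define Y where "Y x = (SOME Y. Y \<in> F x)" for x
  have Y: "Y x \<in> F x" if "x \<in> \<Omega>" for x
    unfolding Y_def using F_nonempty[OF that] by (rule someI_ex)
  define Du where "Du x = slope \<kappa> (Y x - graph x)" for x
  define C' where "C' = slope_const * (C + 1 + 1 / \<gamma>)"
  have C': "0 < C'" using slope_const_pos C gamma_pos by (simp add: C'_def add_pos_pos)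
  have lip: "norm (Du x - Du y) \<le> C' * norm (x - y) powr \<alpha>"
    if xy: "x \<in> ball xs \<delta>" "y \<in> ball xs \<delta>" for x y
  proof (cases "x = y")
    case False
    have O: "x \<in> \<Omega>" "y \<in> \<Omega>" using xy \<delta> by auto
    define d where "d = norm (x - y)"
    have d0: "0 < d" using False by (simp add: d_def)
    have "d \<le> 1"
      using xy \<delta>(1) norm_triangle_ineq4[of "x - xs" "y - xs"] by (simp add: d_def dist_norm norm_minus_commute)
    then have dp: "d \<le> d powr \<alpha>"
      using powr_mono'[of \<alpha> 1 d] d0 \<alpha> by simp
    have "norm (Du x - Du y) \<le> slope_const * norm ((Y x - graph x) - (Y y - graph y))"
      unfolding Du_def slope_const_def
      by (rule slope_lipschitz[OF graph_cone[OF F_target[OF Y[OF O(1)]] O(1)]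
            graph_cone[OF F_target[OF Y[OF O(2)]] O(2)] gamma_pos R kappa])
    also have "norm ((Y x - graph x) - (Y y - graph y)) \<le> norm (Y x - Y y) + norm (graph x - graph y)"
      using norm_triangle_ineq4[of "Y x - Y y" "graph x - graph y"]
      by (simp only: diff_diff_eq2 diff_diff_eq add_diff_eq diff_add_eq add.commute)
    also have "norm (graph x - graph y) \<le> d + d / \<gamma>"
      using norm_Pair_le[of "x - y" "u x - u y"] u_lipschitz[OF O] by (simp add: d_def)
    also have "norm (Y x - Y y) \<le> C * d powr \<alpha>"
      using holder[OF xy False Y[OF O(1)] Y[OF O(2)]] by (simp add: d_def norm_minus_commute)
    also have "C * d powr \<alpha> + (d + d / \<gamma>) \<le> C * d powr \<alpha> + (d powr \<alpha> + d powr \<alpha> / \<gamma>)"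
      using dp gamma_pos by (intro add_left_mono add_mono divide_right_mono) auto
    finally have "norm (Du x - Du y) \<le> slope_const * (C * d powr \<alpha> + (d powr \<alpha> + d powr \<alpha> / \<gamma>))"
      using slope_const_pos by simp
    then show ?thesis by (simp add: C'_def d_def algebra_simps)
  qed simp
  have "GDERIV u x :> Du x" if x: "x \<in> ball xs \<delta>" for x
  proof (rule GDERIV_of_tangent_upper_bound[OF open_ball x \<alpha>(1), where K = tangent_const])
    show "u y \<le> u x + Du x \<bullet> (y - x) + tangent_const * (norm (y - x))\<^sup>2"
      if "x \<in> ball xs \<delta>" "y \<in> ball xs \<delta>" for x y
      unfolding Du_def using that \<delta>(2) by (intro u_le_tangent Y) auto
  qed (rule lip[OF _ x])
  with lip C' show ?thesis unfolding C1_alpha_on_def by blast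
qed

end

theorem corollary6p3:
  fixes \<kappa> M0 \<delta>0 q :: real and p :: ereal
    and \<Omega> \<Omega>s :: "(real^'n) set"
    and S :: "'n::finite point set"
    and s :: "'n point \<Rightarrow> 'n point \<Rightarrow> real"
    and \<sigma> :: "'n point measure"
    and f u \<psi> :: "real^'n \<Rightarrow> real"
    and xs :: "real^'n"
  assumes dim: "CARD('n) \<ge> 2"
    and kappa: "0 < \<kappa>" "\<kappa> < 1"
    and M0: "M0 > 0"
    and delta0: "0 < \<delta>0" "\<delta>0 < 1"
    and Omega: "is_domain \<Omega>" "bounded \<Omega>"
    and target_surface: "is_domain_in_surface S"
    and target_hull: "convex hull S \<subseteq> admissible_targets \<kappa> M0 \<delta>0 \<Omega>"
    and target_param: "parametrized_by (cylinder \<Omega> M0) S s"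
    and target_curves: "curve_condition \<kappa> (cylinder \<Omega> M0) S s"
    and sigma_borel: "sets \<sigma> = sets (restrict_space borel S)"
    and f_nonneg: "\<forall>x\<in>\<Omega>. f x \<ge> 0"
    and p_gt: "p > ereal (real CARD('n))"
    and f_Lp: "in_Lp p \<Omega> f"
    and pq: "1 / p + 1 / ereal q = 1"
    and mass_balance: "emeasure (source_measure \<Omega> f) \<Omega> = emeasure \<sigma> S"
    and refractor: "parallel_refractor \<kappa> M0 \<Omega> S u"
    and solution: "refractor_solution \<kappa> \<Omega> S f \<sigma> u"
    and a: "is_domain \<Omega>s" "C1_on \<Omega>s \<psi>" "S = {(y, \<psi> y) |y. y \<in> \<Omega>s}"
    and b: "\<forall>Y\<in>S. \<forall>X\<in>cylinder \<Omega> M0.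
              {X + t *\<^sub>R (Y - X) |t. t \<in> UNIV} \<inter> tangent_plane \<psi> Y = {Y}"
    and c: "\<forall>E\<in>sets \<sigma>. {y\<in>\<Omega>s. (y, \<psi> y) \<in> E} \<in> null_sets lebesgue \<longrightarrow> emeasure \<sigma> E = 0"
    and xs: "xs \<in> \<Omega>" "(xs, u xs) \<in> cylinder \<Omega> M0"
    and regular: "regular_from \<kappa> M0 \<Omega> S s (xs, u xs)"
    and tube: "tube_condition \<kappa> M0 \<Omega> S s \<sigma> (xs, u xs)"
  shows "\<exists>\<delta>>0. \<exists>C>0. ball xs \<delta> \<subseteq> \<Omega> \<and>
    C1_alpha_on
      ((real CARD('n) / (2 * q) - (real CARD('n) - 1) / 2) /
       (1 + 3 / 2 * (real CARD('n) - 1) + real CARD('n) / (2 * q)))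
      C (ball xs \<delta>) u"
proof -
  have S: "S \<subseteq> admissible_targets \<kappa> M0 \<delta>0 \<Omega>"
    by (rule order_trans[OF hull_subset target_hull])
  have Om: "open \<Omega>" "\<Omega> \<noteq> {}" using Omega(1) by (auto simp: is_domain_def)
  obtain R where R: "0 < R" "\<And>Y x t. \<lbrakk>Y \<in> admissible_targets \<kappa> M0 \<delta>0 \<Omega>; x \<in> \<Omega>; t \<in> {0..M0}\<rbrakk> \<Longrightarrow>
      Y - (x, t) \<in> steep_cone \<kappa> (cone_bound \<kappa> \<delta>0) R \<and> 0 \<le> cost \<kappa> (x, t) Y \<and>
      (\<forall>x'\<in>\<Omega>. (1 - \<kappa>\<^sup>2) * (norm (x' - fst Y))\<^sup>2 \<le> \<delta>0\<^sup>2 * (cost \<kappa> (x, t) Y)\<^sup>2)"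
    by (rule admissible_closed_cylinder[OF kappa delta0 M0 Om]) blast
  interpret refractor_setting \<kappa> M0 \<delta>0 R \<Omega> S s u
  proof unfold_locales
    fix Y x t assume "Y \<in> S" "x \<in> \<Omega>" "t \<in> {0..M0}"
    then show "Y - (x, t) \<in> steep_cone \<kappa> (cone_bound \<kappa> \<delta>0) R \<and> 0 \<le> cost \<kappa> (x, t) Y \<and>
        (\<forall>x'\<in>\<Omega>. (1 - \<kappa>\<^sup>2) * (norm (x' - fst Y))\<^sup>2 \<le> \<delta>0\<^sup>2 * (cost \<kappa> (x, t) Y)\<^sup>2)"
      by (intro R(2) subsetD[OF S])
  qed (fact kappa delta0 R(1) Om(1) target_curves refractor)+
  define N where "N = real CARD('n)"
  have N: "2 \<le> N" using dim by (simp add: N_def)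
  then have "1 \<le> N" by simp
  note q = conjugate_exponent(2,3)[OF pq p_gt[folded N_def] this]
  define A B \<alpha> where "A = N / (2 * q)" and "B = (N - 1) / 2"
    and "\<alpha> = (A - B) / (1 + 3 / 2 * (N - 1) + A)"
  \<comment> \<open>The assumption p > n enters here: it is B < A, which makes \<alpha>
    positive.\<close>
  have AB: "0 < B" "B < A" using q N by (auto simp: A_def B_def)
  have den: "1 + 3 / 2 * (N - 1) + A = 1 + 3 * B + A" by (simp add: B_def)
  have \<alpha>: "0 < \<alpha>" "\<alpha> \<le> 1" using AB unfolding \<alpha>_def den by auto
  obtain Cm where Cm: "0 < Cm" "\<And>A z \<eta>. \<lbrakk>A \<in> sets (source_measure \<Omega> f); A \<subseteq> cball z \<eta>; 0 < \<eta>\<rbrakk> \<Longrightarrow>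
      emeasure (source_measure \<Omega> f) A \<le> ennreal (Cm * \<eta> powr (real CARD('n) / q))"
    by (rule source_measure_cball_bound[OF Om(1) f_nonneg f_Lp p_gt pq]) blast
  obtain \<delta> C where \<delta>: "0 < \<delta>" "2 * \<delta> \<le> 1" "ball xs \<delta> \<subseteq> \<Omega>" and C: "0 < C"
    "\<And>x1 x2 Y1 Y2. \<lbrakk>x1 \<in> ball xs \<delta>; x2 \<in> ball xs \<delta>; x1 \<noteq> x2; Y1 \<in> F x1; Y2 \<in> F x2\<rbrakk> \<Longrightarrow>
      norm (Y1 - Y2) \<le> C * norm (x2 - x1) powr \<alpha>"
    by (rule target_map_holder[OF dim Omega(2) q[unfolded N_def] sigma_borel solution Cm xs(1) regular tube
      \<alpha>_def[unfolded A_def B_def N_def]]) (assumption+, rule that, assumption, assumption, assumption, assumption, simp)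
  have "\<exists>C>0. C1_alpha_on \<alpha> C (ball xs \<delta>) u"
    by (rule refractor_C1_alpha[OF \<delta>(2,3) C(1) \<alpha> C(2)])
  then show ?thesis using \<delta>(1,3) unfolding \<alpha>_def A_def B_def N_def by blast
qed

end
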